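(* Let $m\ge 0$ and $\alpha\in[0,2\pi]$ be real numbers. Let $\Gamma=\langle\iota_1,\iota_2,\iota_3\rangle\subset \mathrm{PU}(2,1)$ be a complex hyperbolic triangle group of type $[m,m,0;3,3,2]$ with angular invariant $\alpha$. If \[ m\ge\log_e(3)\quad\text{and}\quad \cos(\alpha)\le-\frac12, \] then $\Gamma$ is discrete (as a subgroup of $\mathrm{PU}(2,1)$).
   Context: Let $\mathbb{C}^{2,1}$ be $\mathbb{C}^3$ with the Hermitian form $\langle z,w\rangle=z_1\bar w_1+z_2\bar w_2-z_3\bar w_3$. The complex hyperbolic plane $H^2_{\mathbb{C}}$ is the set of negative lines $[z]$ ($\langle z,z\rangle<0$) in the projectivisation, and its boundary $\partial H^2_{\mathbb{C}}$ is the set of null lines. The Bergman metric $\rho$ is given by $\cosh^2(\rho([z],[w])/2)=\frac{\langle z,w\rangle\langle w,z\rangle}{\langle z,z\rangle\langle w,w\rangle}$; the group of holomorphic isometries is $\mathrm{PU}(2,1)$. A complex geodesic is the projectivisation of $\{z:\langle c,z\rangle=0\}$ for a positive vector $c$ ($\langle c,c\rangle>0$), called a polar vector; $c$ is normalised if $\langle c,c\rangle=1$. Two complex geodesics $C,C'$ with normalised polar vectors $c,c'$ are ultra-parallel if they have no common point in $H^2_{\mathbb{C}}\cup\partial H^2_{\mathbb{C}}$; then $|\langle c,c'\rangle|=\cosh(\tfrac12\operatorname{dist}(C,C'))>1$. Two distinct complex geodesics are ideal if they meet in a point of $\partial H^2_{\mathbb{C}}$; then $|\langle c,c'\rangle|=1$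 and $\operatorname{dist}(C,C')=0$. The minimal complex reflection of order $n$ in a complex geodesic $C$ with polar vector $c$ is the element of $\mathrm{PU}(2,1)$ given by $\iota(z)=-z+(1-\mu)\frac{\langle z,c\rangle}{\langle c,c\rangle}c$, where $\mu=\exp(2\pi i/n)$. An $[m_1,m_2,m_3]$-triangle is a triple $(C_1,C_2,C_3)$ of complex geodesics that are pairwise ultra-parallel or ideal, with $m_k=\operatorname{dist}(C_{k-1},C_{k+1})$ for $k=1,2,3$ (indices mod 3; $m_k=0$ is the ideal case). Its angular invariant is $\alpha=\arg\left(\prod_{k=1}^3\langle c_{k-1},c_{k+1}\rangle\right)$, where $c_k$ is a normalised polar vector of $C_k$ (indices mod 3; this does not depend on the choice of the $c_k$). A complex hyperbolic triangle group of type $[m_1,m_2,m_3;n_1,n_2,n_3]$ with angular invariant $\alpha$ is the subgroup of $\mathrm{PU}(2,1)$ generated by the minimal complex reflections $\iota_k$ of order $n_k$ in $C_k$, $k=1,2,3$, for an $[m_1,m_2,m_3]$-triangle $(C_1,C_2,C_3)$ with angular invariant $\alpha$. So for type $[m,m,0;3,3,2]$: $\iota_1,\iota_2$ have order 3, $\iota_3$ has order 2, $\operatorname{dist}(C_2,C_3)=\operatorname{dist}(C_1,C_3)=m$, and $C_1,C_2$ are ideal. *)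

theory Defs
  imports "HOL-Analysis.Analysis" "HOL-Algebra.Generated_Groups"
begin

section \<open>The Hermitian form of signature (2,1)\<close>

definition herm :: "complex^3 \<Rightarrow> complex^3 \<Rightarrow> complex" where
  "herm z w = z$1 * cnj (w$1) + z$2 * cnj (w$2) - z$3 * cnj (w$3)"

lemma herm_add_left: "herm (z + z') w = herm z w + herm z' w"
  by (simp add: herm_def algebra_simps)

lemma herm_add_right: "herm z (w + w') = herm z w + herm z w'"
  by (simp add: herm_def algebra_simps)

lemma herm_scale_left: "herm (k *s z) w = k * herm z w"
  by (simp add: herm_def algebra_simps)

lemma herm_scale_right: "herm z (k *s w) = cnj k * herm z w"
  by (simp add: herm_def algebra_simps)

lemma herm_minus_left: "herm (- z) w = - herm z w"
  by (simp add: herm_def)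

lemma herm_minus_right: "herm z (- w) = - herm z w"
  by (simp add: herm_def)

lemma herm_zero [simp]: "herm 0 w = 0" "herm z 0 = 0"
  by (simp_all add: herm_def)

lemma cnj_herm: "cnj (herm z w) = herm w z"
  by (simp add: herm_def mult.commute)

lemma herm_self: "herm z z = of_real ((cmod (z$1))\<^sup>2 + (cmod (z$2))\<^sup>2 - (cmod (z$3))\<^sup>2)"
  by (simp add: herm_def complex_norm_square flip: of_real_power)

lemma herm_self_of_real: "herm z z = of_real (Re (herm z z))"
  by (simp add: herm_self)

lemma herm_nondegenerate:
  assumes "\<And>w. herm z w = 0"
  shows "z = 0"
proof -
  have "z$1 = 0" "z$2 = 0" "z$3 = 0"
    using assms[of "axis 1 1"] assms[of "axis 2 1"] assms[of "axis 3 1"]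
    by (simp_all add: herm_def axis_def)
  then show ?thesis by (simp add: vec_eq_iff forall_3)
qed


section \<open>The complex hyperbolic plane and its boundary\<close>

definition proj_line :: "complex^3 \<Rightarrow> (complex^3) set" where
  "proj_line z = vec.span {z}"

definition hyp_plane :: "(complex^3) set set" where
  "hyp_plane = {proj_line z |z. Re (herm z z) < 0}"

definition hyp_boundary :: "(complex^3) set set" where
  "hyp_boundary = {proj_line z |z. z \<noteq> 0 \<and> herm z z = 0}"

lemma proj_line_eq: "proj_line z = range (\<lambda>k. k *s z)"
  by (simp add: proj_line_def vec.span_singleton)

lemma proj_line_eqE:
  assumes "proj_line z = proj_line w" "w \<noteq> 0"
  obtains k where "k \<noteq> 0" "w = k *s z"
proof -
  have "1 *s w \<in> proj_line z"
    unfolding assms(1) unfolding proj_line_eq by (rule rangeI)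
  then show ?thesis
    using that assms(2) by (force simp: proj_line_eq)
qed

text \<open>
  The metric is given by \<open>cosh\<^sup>2 (\<rho> / 2) = \<langle>z,w\<rangle> \<langle>w,z\<rangle> / (\<langle>z,z\<rangle> \<langle>w,w\<rangle>)\<close>, where \<open>z\<close> and \<open>w\<close>
  are arbitrary nonzero vectors on the two lines; see \<open>cosh_bergman_dist\<close> below.
\<close>

definition line_rep :: "(complex^3) set \<Rightarrow> complex^3" where
  "line_rep p = (SOME z. z \<noteq> 0 \<and> p = proj_line z)"

definition bergman_dist :: "(complex^3) set \<Rightarrow> (complex^3) set \<Rightarrow> real" where
  "bergman_dist p q =
     (let z = line_rep p; w = line_rep q
      in 2 * arcosh (sqrt (Re ((herm z w * herm w z) / (herm z z * herm w w)))))"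

lemma line_rep:
  assumes "z \<noteq> 0"
  obtains k where "k \<noteq> 0" "line_rep (proj_line z) = k *s z"
proof -
  have "line_rep (proj_line z) \<noteq> 0 \<and> proj_line z = proj_line (line_rep (proj_line z))"
    unfolding line_rep_def by (rule someI[of _ z]) (use assms in auto)
  then show ?thesis using proj_line_eqE that by metis
qed

lemma reversed_Cauchy_Schwarz:
  assumes z: "Re (herm z z) < 0" and w: "Re (herm w w) < 0"
  shows "Re (herm z z) * Re (herm w w) \<le> (cmod (herm z w))\<^sup>2"
proof -
  define p where "p = (cmod (z$1))\<^sup>2 + (cmod (z$2))\<^sup>2"
  define q where "q = (cmod (w$1))\<^sup>2 + (cmod (w$2))\<^sup>2"
  define a where "a = cmod (z$3)"
  define b where "b = cmod (w$3)"
  have pq0: "p \<ge> 0" "q \<ge> 0" "a \<ge> 0" "b \<ge> 0" by (auto simp: p_def q_def a_def b_def)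
  have pa: "p < a\<^sup>2" and qb: "q < b\<^sup>2"
    using z w by (auto simp: herm_self p_def q_def a_def b_def)
  have "cmod (z$1 * cnj (w$1) + z$2 * cnj (w$2)) \<le> cmod (z$1) * cmod (w$1) + cmod (z$2) * cmod (w$2)"
    by (metis norm_triangle_ineq norm_mult complex_mod_cnj)
  also have "\<dots> \<le> sqrt (p * q)"
  proof (rule real_le_rsqrt)
    have "0 \<le> (cmod (z$1) * cmod (w$2) - cmod (z$2) * cmod (w$1))\<^sup>2" by simp
    then show "(cmod (z$1) * cmod (w$1) + cmod (z$2) * cmod (w$2))\<^sup>2 \<le> p * q"
      by (simp add: p_def q_def power2_eq_square algebra_simps)
  qed
  finally have 1: "cmod (z$1 * cnj (w$1) + z$2 * cnj (w$2)) \<le> sqrt (p * q)" .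
  have "cmod (z$3 * cnj (w$3)) - cmod (z$1 * cnj (w$1) + z$2 * cnj (w$2)) \<le> cmod (herm z w)"
    unfolding herm_def by (metis norm_triangle_ineq2 norm_minus_commute)
  with 1 have 2: "a * b - sqrt (p * q) \<le> cmod (herm z w)"
    by (simp add: norm_mult a_def b_def)
  have "sqrt p \<le> a" "sqrt q \<le> b"
    using pa qb pq0 by (auto intro: real_le_lsqrt)
  then have "sqrt (p * q) \<le> a * b"
    by (simp add: real_sqrt_mult mult_mono pq0)
  then have 3: "(a * b - sqrt (p * q))\<^sup>2 \<le> (cmod (herm z w))\<^sup>2"
    using 2 by (intro power_mono) auto
  have "0 \<le> (a * sqrt q - b * sqrt p)\<^sup>2" by simp
  then have "(a\<^sup>2 - p) * (b\<^sup>2 - q) \<le> (a * b - sqrt (p * q))\<^sup>2"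
    using pq0 by (simp add: power2_diff power_mult_distrib real_sqrt_mult algebra_simps)
  also have "(a\<^sup>2 - p) * (b\<^sup>2 - q) = Re (herm z z) * Re (herm w w)"
    by (simp add: herm_self p_def q_def a_def b_def algebra_simps)
  finally show ?thesis using 3 by linarith
qed

lemma cosh_bergman_dist:
  assumes z: "Re (herm z z) < 0" and w: "Re (herm w w) < 0"
  shows "0 \<le> bergman_dist (proj_line z) (proj_line w)"
    and "of_real ((cosh (bergman_dist (proj_line z) (proj_line w) / 2))\<^sup>2)
           = (herm z w * herm w z) / (herm z z * herm w w)"
proof -
  have "z \<noteq> 0" "w \<noteq> 0" using z w by auto
  obtain k where k: "k \<noteq> 0" "line_rep (proj_line z) = k *s z" using \<open>z \<noteq> 0\<close> by (rule line_rep)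
  obtain l where l: "l \<noteq> 0" "line_rep (proj_line w) = l *s w" using \<open>w \<noteq> 0\<close> by (rule line_rep)
  define Q where "Q = (cmod (herm z w))\<^sup>2 / (Re (herm z z) * Re (herm w w))"
  have num: "herm z w * herm w z = of_real ((cmod (herm z w))\<^sup>2)"
    by (metis cnj_herm complex_norm_square)
  have Q: "(herm z w * herm w z) / (herm z z * herm w w) = of_real Q"
    unfolding num Q_def by (subst (1 2) herm_self_of_real) simp
  have eq: "(herm (k *s z) (l *s w) * herm (l *s w) (k *s z))
      / (herm (k *s z) (k *s z) * herm (l *s w) (l *s w)) = of_real Q"
    unfolding Q[symmetric] using k l by (simp add: herm_scale_left herm_scale_right)
  have d: "bergman_dist (proj_line z) (proj_line w) = 2 * arcosh (sqrt Q)"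
    by (simp add: bergman_dist_def k l eq)
  have pos: "0 < Re (herm z z) * Re (herm w w)" using z w by (rule mult_neg_neg)
  have "1 \<le> Q"
    unfolding Q_def using reversed_Cauchy_Schwarz[OF z w] pos by (simp add: le_divide_eq)
  then have "1 \<le> sqrt Q" by simp
  with \<open>1 \<le> Q\<close> show "0 \<le> bergman_dist (proj_line z) (proj_line w)"
    and "of_real ((cosh (bergman_dist (proj_line z) (proj_line w) / 2))\<^sup>2)
           = (herm z w * herm w z) / (herm z z * herm w w)"
    unfolding d Q by auto
qed


section \<open>Complex geodesics\<close>

text \<open>
  A complex geodesic is taken as a full projective line, so that it includes its points in the
  boundary as well as positive lines. Incidence and distance below intersect it explicitly with
  the hyperbolic plane and its boundary.
\<close>

definition polar_vector :: "(complex^3) set set \<Rightarrow> complex^3 \<Rightarrow> bool" where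
  "polar_vector C c \<longleftrightarrow>
     0 < Re (herm c c) \<and> C = {proj_line z |z. z \<noteq> 0 \<and> herm c z = 0}"

definition normalised_polar_vector :: "(complex^3) set set \<Rightarrow> complex^3 \<Rightarrow> bool" where
  "normalised_polar_vector C c \<longleftrightarrow> polar_vector C c \<and> herm c c = 1"

definition complex_geodesic :: "(complex^3) set set \<Rightarrow> bool" where
  "complex_geodesic C \<longleftrightarrow> (\<exists>c. polar_vector C c)"

definition ultra_parallel :: "(complex^3) set set \<Rightarrow> (complex^3) set set \<Rightarrow> bool" where
  "ultra_parallel C C' \<longleftrightarrow> C \<inter> C' \<inter> (hyp_plane \<union> hyp_boundary) = {}"

definition ideal_pair :: "(complex^3) set set \<Rightarrow> (complex^3) set set \<Rightarrow> bool" where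
  "ideal_pair C C' \<longleftrightarrow> C \<noteq> C' \<and> C \<inter> C' \<inter> hyp_boundary \<noteq> {}"

definition geodesic_dist :: "(complex^3) set set \<Rightarrow> (complex^3) set set \<Rightarrow> real" where
  "geodesic_dist C C' = (INF (p, q) \<in> (C \<inter> hyp_plane) \<times> (C' \<inter> hyp_plane). bergman_dist p q)"

definition is_triangle ::
    "(complex^3) set set \<Rightarrow> (complex^3) set set \<Rightarrow> (complex^3) set set
       \<Rightarrow> real \<Rightarrow> real \<Rightarrow> real \<Rightarrow> bool" where
  "is_triangle C1 C2 C3 m1 m2 m3 \<longleftrightarrow>
     complex_geodesic C1 \<and> complex_geodesic C2 \<and> complex_geodesic C3 \<and>
     (ultra_parallel C2 C3 \<or> ideal_pair C2 C3) \<and>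
     (ultra_parallel C3 C1 \<or> ideal_pair C3 C1) \<and>
     (ultra_parallel C1 C2 \<or> ideal_pair C1 C2) \<and>
     m1 = geodesic_dist C3 C2 \<and> m2 = geodesic_dist C1 C3 \<and> m3 = geodesic_dist C2 C1"

text \<open>The angular invariant is an argument, determined only modulo \<open>2 \<pi>\<close>.\<close>

definition angular_invariant ::
    "(complex^3) set set \<Rightarrow> (complex^3) set set \<Rightarrow> (complex^3) set set \<Rightarrow> real \<Rightarrow> bool" where
  "angular_invariant C1 C2 C3 \<alpha> \<longleftrightarrow>
     (\<exists>c1 c2 c3. normalised_polar_vector C1 c1 \<and> normalised_polar_vector C2 c2 \<and>
        normalised_polar_vector C3 c3 \<and>
        is_Arg (herm c3 c2 * herm c1 c3 * herm c2 c1) \<alpha>)"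

lemma polar_vector_unique:
  assumes c: "polar_vector C c" and d: "polar_vector C d"
  obtains k where "k \<noteq> 0" "d = k *s c"
proof -
  define a where "a = herm d c / herm c c"
  define e where "e = d - a *s c"
  have cc: "herm c c \<noteq> 0" using c by (auto simp: polar_vector_def)
  have d_eq: "d = e + a *s c" by (simp add: e_def)
  have "herm d c = herm e c + a * herm c c"
    by (subst d_eq) (simp add: herm_add_left herm_scale_left)
  then have ec: "herm e c = 0" using cc by (simp add: a_def)
  have perp: "herm e z = 0" if z: "herm c z = 0" for z
  proof (cases "z = 0")
    case False
    have "proj_line z \<in> C" using c z False by (auto simp: polar_vector_def)
    then obtain w where w: "w \<noteq> 0" "herm d w = 0" "proj_line z = proj_line w"
      using d by (auto simp: polar_vector_def)
    obtain k where "w = k *s z" "k \<noteq> 0" using w by (metis proj_line_eqE)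
    then have "herm d z = 0" using w by (simp add: herm_scale_right)
    then show ?thesis using z by (simp add: d_eq herm_add_left herm_scale_left)
  qed simp
  have "e = 0"
  proof (rule herm_nondegenerate)
    fix w
    define b where "b = cnj (herm c w / herm c c)"
    have w_eq: "w = (w - b *s c) + b *s c" by simp
    have "herm c (w - b *s c) = herm c w - cnj b * herm c c"
      using herm_add_right[of c "w - b *s c" "b *s c"] by (simp add: herm_scale_right)
    then have "herm c (w - b *s c) = 0" using cc by (simp add: b_def)
    then show "herm e w = 0"
      by (subst w_eq) (simp only: herm_add_right herm_scale_right perp ec, simp)
  qed
  then have "d = a *s c" using d_eq by simp
  moreover have "a \<noteq> 0" using d calculation by (auto simp: polar_vector_def)
  ultimately show ?thesis using that by blast
qed


section \<open>The group \<open>PU(2,1)\<close> and its topology\<close>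

definition U21 :: "(complex^3^3) monoid" where
  "U21 = \<lparr>carrier = {A. \<forall>z w. herm (A *v z) (A *v w) = herm z w}, mult = (**), one = mat 1\<rparr>"

text \<open>The scalar matrices in \<open>U(2,1)\<close>; note that \<open>mat k\<close> is \<open>k\<close> times the identity matrix.\<close>

definition unit_scalars :: "(complex^3^3) set" where
  "unit_scalars = {mat k |k. cmod k = 1}"

definition PU21 :: "(complex^3^3) set monoid" where
  "PU21 = U21 Mod unit_scalars"

definition proj_class :: "complex^3^3 \<Rightarrow> (complex^3^3) set" where
  "proj_class A = unit_scalars #>\<^bsub>U21\<^esub> A"

text \<open>The quotient topology of the topology of \<open>U(2,1)\<close> as a subspace of the space of matrices.\<close>

definition PU21_topology :: "(complex^3^3) set topology" where
  "PU21_topology = topology (\<lambda>W. W \<subseteq> carrier PU21 \<and>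
     openin (top_of_set (carrier U21)) {A \<in> carrier U21. proj_class A \<in> W})"

definition discrete_subgroup :: "(complex^3^3) set set \<Rightarrow> bool" where
  "discrete_subgroup \<Gamma> \<longleftrightarrow>
     subgroup \<Gamma> PU21 \<and> subtopology PU21_topology \<Gamma> = discrete_topology \<Gamma>"

lemma mat_mult_vec: "mat k *v z = k *s (z :: complex^3)"
  by (simp add: vec_eq_iff matrix_vector_mult_def mat_def if_distrib[of "\<lambda>x. x * _"] cong: if_cong)

lemma mat_matrix_mult: "mat k ** A = (\<chi> i j. k * A$i$j)" for A :: "complex^3^3"
  by (simp add: vec_eq_iff matrix_matrix_mult_def mat_def if_distrib[of "\<lambda>x. x * _"] cong: if_cong)

lemma matrix_mult_mat: "A ** mat k = (\<chi> i j. k * A$i$j)" for A :: "complex^3^3"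
  by (simp add: vec_eq_iff matrix_matrix_mult_def mat_def if_distrib cong: if_cong)

lemma group_U21: "group U21"
proof (rule groupI)
  fix A assume A: "A \<in> carrier U21"
  have "A *v z = 0 \<Longrightarrow> z = 0" for z
    by (rule herm_nondegenerate) (use A in \<open>metis (mono_tags, lifting) U21_def herm_zero(1) mem_Collect_eq partial_object.select_convs(1)\<close>)
  then obtain B where B: "B ** A = mat 1"
    using matrix_left_invertible_ker[of A] by blast
  then have B': "A ** B = mat 1" by (simp add: matrix_left_right_inverse)
  have "herm (B *v z) (B *v w) = herm z w" for z w
  proof -
    have "herm (B *v z) (B *v w) = herm (A *v (B *v z)) (A *v (B *v w))"
      using A by (simp add: U21_def)
    then show ?thesis by (simp add: matrix_vector_mul_assoc B')
  qed
  then show "\<exists>B \<in> carrier U21. B \<otimes>\<^bsub>U21\<^esub> A = \<one>\<^bsub>U21\<^esub>"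
    using B by (auto simp: U21_def)
qed (auto simp: U21_def matrix_mul_assoc simp flip: matrix_vector_mul_assoc)

lemma unit_scalars_normal: "unit_scalars \<lhd> U21"
proof -
  interpret group U21 by (rule group_U21)
  have mm: "mat k ** mat l = (mat (k * l) :: complex^3^3)" for k l
    by (simp add: mat_matrix_mult) (simp add: mat_def vec_eq_iff)
  have sub: "unit_scalars \<subseteq> carrier U21"
  proof -
    have "k * cnj k = 1" if "cmod k = 1" for k
      using complex_norm_square[of k] that by simp
    then have "cnj k * (k * x) = x" "k * (cnj k * x) = x" if "cmod k = 1" for k x
      using that by (metis mult.assoc mult.commute mult_1)+
    then show ?thesis
      by (auto simp: unit_scalars_def U21_def mat_mult_vec herm_scale_left herm_scale_right)
  qed
  have "subgroup unit_scalars U21"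
  proof (rule subgroupI)
    show "unit_scalars \<noteq> {}" by (auto simp: unit_scalars_def intro: exI[of _ 1])
  next
    fix A assume "A \<in> unit_scalars"
    then obtain k where k: "A = mat k" "cmod k = 1" by (auto simp: unit_scalars_def)
    have i: "mat (inverse k) \<in> unit_scalars" using k by (auto simp: unit_scalars_def norm_inverse)
    have "k \<noteq> 0" using k by auto
    then have "mat (inverse k) \<otimes>\<^bsub>U21\<^esub> A = \<one>\<^bsub>U21\<^esub>" using k by (simp add: U21_def mm)
    then have "inv\<^bsub>U21\<^esub> A = mat (inverse k)"
      using i sub \<open>A \<in> unit_scalars\<close> by (intro inv_equality) auto
    with i show "inv\<^bsub>U21\<^esub> A \<in> unit_scalars" by simp
  next
    fix A B assume "A \<in> unit_scalars" "B \<in> unit_scalars"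
    then show "A \<otimes>\<^bsub>U21\<^esub> B \<in> unit_scalars"
      unfolding unit_scalars_def U21_def by (force simp: mm norm_mult)
  qed (rule sub)
  then show ?thesis
  proof (rule normalI, intro ballI)
    fix A :: "complex^3^3"
    have "mat k ** A = A ** mat k" for k by (simp add: mat_matrix_mult matrix_mult_mat)
    then show "unit_scalars #>\<^bsub>U21\<^esub> A = A <#\<^bsub>U21\<^esub> unit_scalars"
      by (auto simp: r_coset_def l_coset_def U21_def unit_scalars_def)
  qed
qed

lemma group_PU21: "group PU21"
  unfolding PU21_def by (rule normal.factorgroup_is_group[OF unit_scalars_normal])

lemma carrier_PU21: "carrier PU21 = proj_class ` carrier U21"
  by (auto simp: PU21_def FactGroup_def RCOSETS_def proj_class_def)

lemma openin_PU21_topology: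
  "openin PU21_topology W \<longleftrightarrow> W \<subseteq> carrier PU21 \<and>
     openin (top_of_set (carrier U21)) {A \<in> carrier U21. proj_class A \<in> W}"
proof -
  let ?P = "\<lambda>W. {A \<in> carrier U21. proj_class A \<in> W}"
  have 1: "?P (S \<inter> T) = ?P S \<inter> ?P T" for S T by auto
  have 2: "?P (\<Union>\<K>) = \<Union> (?P ` \<K>)" for \<K> by auto
  have "istopology (\<lambda>W. W \<subseteq> carrier PU21 \<and> openin (top_of_set (carrier U21)) (?P W))"
    unfolding istopology_def 1 2 by (blast intro: openin_Int openin_Union)
  then show ?thesis by (simp add: PU21_topology_def)
qed

lemma quotient_map_proj_class: "quotient_map (top_of_set (carrier U21)) PU21_topology proj_class"
proof -
  have "openin PU21_topology (carrier PU21)"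
  proof -
    have "{A \<in> carrier U21. proj_class A \<in> carrier PU21} = carrier U21"
      by (auto simp: carrier_PU21)
    then show ?thesis by (simp add: openin_PU21_topology)
  qed
  then have "topspace PU21_topology = carrier PU21"
    using openin_PU21_topology[of "topspace PU21_topology"] by (auto dest: openin_subset)
  then show ?thesis
    unfolding quotient_map_def by (simp add: openin_PU21_topology) (simp add: carrier_PU21)
qed


section \<open>Complex reflections and triangle groups\<close>

definition minimal_reflection_matrix :: "nat \<Rightarrow> complex^3 \<Rightarrow> complex^3^3" where
  "minimal_reflection_matrix n c =
     matrix (\<lambda>z. - z + ((1 - exp (2 * of_real pi * \<i> / of_nat n)) * (herm z c / herm c c)) *s c)"

text \<open>The element of \<open>PU(2,1)\<close> does not depend on the choice of the polar vector;
  see \<open>minimal_reflection_eq\<close> below.\<close>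

definition minimal_reflection :: "nat \<Rightarrow> (complex^3) set set \<Rightarrow> (complex^3^3) set" where
  "minimal_reflection n C = proj_class (minimal_reflection_matrix n (SOME c. polar_vector C c))"

definition triangle_group ::
    "real \<Rightarrow> real \<Rightarrow> real \<Rightarrow> nat \<Rightarrow> nat \<Rightarrow> nat \<Rightarrow> real \<Rightarrow> (complex^3^3) set set \<Rightarrow> bool" where
  "triangle_group m1 m2 m3 n1 n2 n3 \<alpha> \<Gamma> \<longleftrightarrow>
     (\<exists>C1 C2 C3. is_triangle C1 C2 C3 m1 m2 m3 \<and> angular_invariant C1 C2 C3 \<alpha> \<and>
        \<Gamma> = generate PU21
              {minimal_reflection n1 C1, minimal_reflection n2 C2, minimal_reflection n3 C3})"

lemma minimal_reflection_matrix_mult_vec: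
  "minimal_reflection_matrix n c *v z =
     - z + ((1 - exp (2 * of_real pi * \<i> / of_nat n)) * (herm z c / herm c c)) *s c"
  unfolding minimal_reflection_matrix_def
  by (rule matrix_works, unfold_locales)
    (simp_all add: vec_eq_iff herm_add_left herm_scale_left algebra_simps add_divide_distrib)

lemma minimal_reflection_matrix_U21:
  assumes "0 < Re (herm c c)"
  shows "minimal_reflection_matrix n c \<in> carrier U21"
proof -
  define \<mu> where "\<mu> = exp (2 * of_real pi * \<i> / of_nat n)"
  have "\<mu> = cis (2 * pi / n)" by (simp add: \<mu>_def cis_conv_exp mult_ac)
  then have mu: "\<mu> * cnj \<mu> = 1" by (simp add: complex_norm_square[symmetric])
  have cc: "herm c c \<noteq> 0" "cnj (herm c c) = herm c c" using assms by (auto simp: cnj_herm)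
  have "herm (minimal_reflection_matrix n c *v z) (minimal_reflection_matrix n c *v w)
      = herm z w" for z w
  proof -
    have "herm (minimal_reflection_matrix n c *v z) (minimal_reflection_matrix n c *v w)
      = herm z w + (herm z c * herm c w / herm c c) * ((1 - \<mu>) * (1 - cnj \<mu>) - (1 - \<mu>) - (1 - cnj \<mu>))"
    proof -
      have "herm (- z + u *s c) (- w + v *s c)
          = herm z w - cnj v * herm z c - u * herm c w + u * cnj v * herm c c" for u v
        by (simp only: herm_add_left herm_add_right herm_scale_left herm_scale_right
            herm_minus_left herm_minus_right) (simp add: algebra_simps)
      moreover have "cnj ((1 - \<mu>) * (herm w c / herm c c)) = (1 - cnj \<mu>) * (herm c w / herm c c)"
        by (simp add: cnj_herm)
      moreover have "x - q * (b / h) * a - p * (a / h) * b + p * (a / h) * (q * (b / h)) * h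
          = x + (a * b / h) * (p * q - p - q)" if "h \<noteq> 0" for x p q a b h :: complex
        using that by (simp add: field_simps)
      ultimately show ?thesis
        unfolding minimal_reflection_matrix_mult_vec \<mu>_def[symmetric] using cc(1) by metis
    qed
    also have "(1 - \<mu>) * (1 - cnj \<mu>) - (1 - \<mu>) - (1 - cnj \<mu>) = 0"
      using mu by (simp add: algebra_simps)
    finally show ?thesis by simp
  qed
  then show ?thesis by (simp add: U21_def)
qed

lemma minimal_reflection_eq:
  assumes "polar_vector C c"
  shows "minimal_reflection n C = proj_class (minimal_reflection_matrix n c)"
proof -
  define d where "d = (SOME c. polar_vector C c)"
  have "polar_vector C d" unfolding d_def using assms by (rule someI)
  then obtain k where k: "k \<noteq> 0" "d = k *s c" using assms by (metis polar_vector_unique)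
  have "minimal_reflection_matrix n d *v z = minimal_reflection_matrix n c *v z" for z
    unfolding minimal_reflection_matrix_mult_vec
    using k(1) unfolding k(2) by (simp add: herm_scale_left herm_scale_right)
  then have "minimal_reflection_matrix n d = minimal_reflection_matrix n c"
    by (simp add: matrix_eq)
  then show ?thesis by (simp add: minimal_reflection_def d_def)
qed

end

theory Submission
  imports Defs
begin

text \<open>
  The argument is a ping-pong for the free product of the subgroup generated by \<open>\<iota>\<^sub>1\<close> and \<open>\<iota>\<^sub>2\<close>
  and the group of order two generated by \<open>\<iota>\<^sub>3\<close>.

  Write \<open>J\<close> for \<open>\<iota>\<^sub>3\<close>. Let \<open>p\<close> be a null vector on the common boundary point of \<open>C\<^sub>1\<close> and
  \<open>C\<^sub>2\<close> and let \<open>q = J p\<close>. Since \<open>J\<close> exchanges \<open>p\<close> and \<open>q\<close>, it exchanges the sides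
  \<open>\<bar>\<langle>z, q\<rangle>\<bar> \<le> \<bar>\<langle>z, p\<rangle>\<bar>\<close> and \<open>\<bar>\<langle>z, p\<rangle>\<bar> \<le> \<bar>\<langle>z, q\<rangle>\<bar>\<close> of its isometric sphere. Suppose that every
  nontrivial element of the subgroup generated by \<open>\<iota>\<^sub>1\<close> and \<open>\<iota>\<^sub>2\<close>, which fixes \<open>p\<close>, moves the
  inner side, the isometric ball, into the outer one. Then every reduced word that contains \<open>J\<close> maps a high horoball at \<open>p\<close>
  into the ball or one of its images (lemma \<open>alternating_horoball\<close>), hence off itself, and is not close to the
  identity.

  By a Cygan-type triangle inequality (lemma \<open>isometric_balls_disjoint\<close>) two balls are disjoint if their centres
  satisfy \<open>\<bar>\<langle>q, q'\<rangle>\<bar> \<ge> 4 \<langle>q, p\<rangle>\<close>, so that only the displacement of the point \<open>q\<close> has to be estimated (lemma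
  \<open>stab_displacement\<close>). In the Heisenberg group at \<open>p\<close> the reflections \<open>\<iota>\<^sub>1\<close> and \<open>\<iota>\<^sub>2\<close> are rotations
  by \<open>2 \<pi> / 3\<close> about two vertical lines. With these lines placed over \<open>0\<close> and \<open>1\<close>, the whole group acts by
  matrices over the Eisenstein integers, and its elements are rotations about lines over lattice points,
  horizontal translations and vertical translations. The point \<open>q\<close> is equidistant from the two lines, at a
  distance that is \<open>cosh (m / 2)\<close> times the radius of the ball. The condition \<open>cos \<alpha> \<le> - 1 / 2\<close> says that \<open>q\<close> is
  on the Voronoi edge between \<open>0\<close> and \<open>1\<close> (lemma \<open>eisenstein_voronoi_edge\<close>), so that \<open>\<iota>\<^sub>1\<close> and \<open>\<iota>\<^sub>2\<close>
  move it least among all rotations; the condition \<open>m \<ge> ln 3\<close> says that their horizontal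
  displacement of \<open>q\<close>, which is \<open>sqrt 3 cosh (m / 2)\<close> times the radius, is at least twice the radius. Translations
  also displace \<open>q\<close> by at least twice the radius, vertical ones in terms of the product \<open>\<langle>q, q'\<rangle>\<close>.

  Finally the hypotheses have to be read in terms of the polar vectors. The distance of two complex geodesics is
  defined as an infimum, and lemma \<open>geodesic_dist_eq_arcosh\<close> evaluates it as \<open>2 arcosh \<bar>\<langle>c, c'\<rangle>\<bar>\<close>.
\<close>

section \<open>Eisenstein integers\<close>

definition omega :: complex where
  "omega = exp (2 * of_real pi * \<i> / of_nat 3)"

lemma omega_eq: "omega = Complex (- 1 / 2) (sqrt 3 / 2)"
proof -
  have "omega = cis (2 * pi / 3)"
    by (simp add: omega_def cis_conv_exp mult_ac)
  then show ?thesis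
    by (simp add: complex_eq_iff cos_120 sin_120)
qed

lemma omega_square: "omega * omega = - 1 - omega"
  by (simp add: omega_eq complex_eq_iff)

lemma cmod_one_minus_omega: "(cmod (1 - omega))\<^sup>2 = 3"
  by (simp add: omega_eq cmod_power2 power_divide)

definition eisenstein :: "complex set" where
  "eisenstein = {of_int m + of_int n * omega |m n. True}"

lemma eisensteinI: "of_int m + of_int n * omega \<in> eisenstein"
  by (auto simp: eisenstein_def)

lemma eisenstein_add: "x \<in> eisenstein \<Longrightarrow> y \<in> eisenstein \<Longrightarrow> x + y \<in> eisenstein"
proof -
  assume "x \<in> eisenstein" "y \<in> eisenstein"
  then obtain a b c d where "x = of_int a + of_int b * omega" "y = of_int c + of_int d * omega"
    by (auto simp: eisenstein_def)
  then have "x + y = of_int (a + c) + of_int (b + d) * omega"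
    by (simp add: algebra_simps)
  then show ?thesis using eisensteinI by metis
qed

lemma eisenstein_mult: "x \<in> eisenstein \<Longrightarrow> y \<in> eisenstein \<Longrightarrow> x * y \<in> eisenstein"
proof -
  assume "x \<in> eisenstein" "y \<in> eisenstein"
  then obtain a b c d where "x = of_int a + of_int b * omega" "y = of_int c + of_int d * omega"
    by (auto simp: eisenstein_def)
  then have "x * y = of_int (a * c) + of_int (a * d + b * c) * omega + of_int (b * d) * (omega * omega)"
    by (simp add: algebra_simps)
  also have "\<dots> = of_int (a * c - b * d) + of_int (a * d + b * c - b * d) * omega"
    by (simp add: omega_square algebra_simps)
  finally show ?thesis using eisensteinI by metis
qed

lemma eisenstein_0: "0 \<in> eisenstein" and eisenstein_1: "1 \<in> eisenstein"
  and eisenstein_omega: "omega \<in> eisenstein"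
  using eisensteinI[of 0 0] eisensteinI[of 1 0] eisensteinI[of 0 1] by simp_all

lemma eisenstein_minus: "x \<in> eisenstein \<Longrightarrow> - x \<in> eisenstein"
  using eisenstein_mult[OF eisensteinI[of "-1" 0], of x] by simp

lemma eisenstein_diff: "x \<in> eisenstein \<Longrightarrow> y \<in> eisenstein \<Longrightarrow> x - y \<in> eisenstein"
  using eisenstein_add[OF _ eisenstein_minus, of x y] by simp

lemmas eisenstein_intros =
  eisenstein_0 eisenstein_1 eisenstein_omega eisenstein_add eisenstein_mult eisenstein_minus
  eisenstein_diff

lemma eisenstein_cnj: "x \<in> eisenstein \<Longrightarrow> cnj x \<in> eisenstein"
proof -
  assume "x \<in> eisenstein"
  then obtain a b where "x = of_int a + of_int b * omega"
    by (auto simp: eisenstein_def)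
  then have "cnj x = of_int a + of_int b * (- 1 - omega)"
    by (simp add: omega_eq complex_eq_iff)
  also have "\<dots> \<in> eisenstein"
    using eisensteinI[of "a - b" "- b"] by (simp add: algebra_simps)
  finally show ?thesis .
qed

lemma cmod_eisenstein:
  "(cmod (of_int m + of_int n * omega))\<^sup>2 = of_int (m * m - m * n + n * n)"
  unfolding cmod_power2 by (simp add: omega_eq power2_eq_square algebra_simps)

lemma eisenstein_cmod_int: "x \<in> eisenstein \<Longrightarrow> \<exists>k::int. (cmod x)\<^sup>2 = of_int k"
  unfolding eisenstein_def using cmod_eisenstein by blast

lemma eisenstein_cmod_ge_1: "x \<in> eisenstein \<Longrightarrow> x \<noteq> 0 \<Longrightarrow> 1 \<le> (cmod x)\<^sup>2"
proof -
  assume x: "x \<in> eisenstein" "x \<noteq> 0"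
  then obtain k :: int where k: "(cmod x)\<^sup>2 = of_int k" using eisenstein_cmod_int by blast
  moreover have "0 < (cmod x)\<^sup>2" using x by simp
  ultimately show ?thesis by simp
qed

lemma eisenstein_small_unit:
  assumes "x \<in> eisenstein" "x \<noteq> 0" "(cmod x)\<^sup>2 < 2"
  shows "(cmod x)\<^sup>2 = 1"
proof -
  obtain k :: int where k: "(cmod x)\<^sup>2 = of_int k" using eisenstein_cmod_int assms by blast
  moreover have "1 \<le> (cmod x)\<^sup>2" using assms eisenstein_cmod_ge_1 by blast
  ultimately have "k = 1" using assms(3) by simp
  then show ?thesis using k by simp
qed

text \<open>
  The points equidistant from \<open>0\<close> and \<open>1\<close> and within \<open>1 / sqrt 3\<close> of them form the segment
  between the centres of the two equilateral lattice triangles on the edge from \<open>0\<close> to \<open>1\<close>. This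
  is an edge of the hexagonal Voronoi decomposition, so no lattice point is closer than \<open>0\<close> and \<open>1\<close>.
\<close>

lemma eisenstein_voronoi_edge:
  assumes mid: "cmod x = cmod (x - 1)" and small: "3 * (cmod x)\<^sup>2 \<le> 1" and e: "e \<in> eisenstein"
  shows "cmod x \<le> cmod (x + e)"
proof -
  obtain m n where mn: "e = - (of_int m + of_int n * omega)"
    using eisenstein_minus[OF e] unfolding eisenstein_def mem_Collect_eq by (metis minus_minus)
  define y where "y = Im x"
  have "(cmod x)\<^sup>2 = (cmod (x - 1))\<^sup>2" using mid by simp
  then have re: "Re x = 1 / 2"
    unfolding cmod_power2 by (simp add: power2_eq_square algebra_simps)
  have "y\<^sup>2 \<le> 1 / 12"
    using small by (simp add: cmod_power2 re y_def power_divide)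
  then have "(2 * sqrt 3 * y)\<^sup>2 \<le> 1" by (simp add: power_mult_distrib)
  then have y: "\<bar>2 * sqrt 3 * y\<bar> \<le> 1" by (simp add: abs_square_le_1)
  have "\<bar>of_int n * (2 * sqrt 3 * y)\<bar> \<le> \<bar>of_int n\<bar> * 1"
    unfolding abs_mult[of "of_int n"] using y by (intro mult_left_mono) auto
  then have n: "2 * of_int n * sqrt 3 * y \<le> \<bar>of_int n\<bar>" by (simp add: mult_ac)
  \<comment> \<open>The bound on \<open>y\<close> reduces the claim to an inequality of integers; for \<open>n \<ge> 0\<close> twice
    its right-hand side is \<open>(2 m - n - 1)\<^sup>2 + (3 n + 1) (n - 1)\<close>, and the substitution \<open>m \<mapsto> m - n\<close>,
    \<open>n \<mapsto> - n\<close> reduces the case \<open>n < 0\<close> to this one.\<close>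
  have int: "0 \<le> 2 * (m * m - m * n + n * n) - 2 * m + n - \<bar>n\<bar>"
  proof -
    have pos: "0 \<le> (3 * k + 1) * (k - 1) + (2 * l - k - 1)\<^sup>2" if "0 \<le> k" for k l :: int
    proof (cases "k = 0")
      case True
      have "2 * l \<noteq> 1" by presburger
      then have "0 < (2 * l - 1)\<^sup>2" by simp
      then show ?thesis using True by simp
    qed (use that in auto)
    show ?thesis
    proof (cases "0 \<le> n")
      case True
      then show ?thesis using pos[of n m] by (simp add: power2_eq_square algebra_simps)
    next
      case False
      then show ?thesis using pos[of "- n" "m - n"] by (simp add: power2_eq_square algebra_simps)
    qed
  qed
  then have "(0::real) \<le> of_int (2 * (m * m - m * n + n * n) - 2 * m + n - \<bar>n\<bar>)"
    using of_int_0_le_iff by blast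
  then have "0 \<le> 2 * (of_int m * of_int m - of_int m * of_int n + of_int n * of_int n)
      - 2 * of_int m + of_int n - 2 * of_int n * sqrt 3 * y"
    using n by simp
  also have "\<dots> = 2 * ((cmod (x + e))\<^sup>2 - (cmod x)\<^sup>2)"
    unfolding cmod_power2 by (simp add: mn omega_eq re y_def power2_eq_square algebra_simps)
  finally show ?thesis by (simp add: power2_le_iff_abs_le)
qed

section \<open>Null vectors and isometric balls\<close>

lemma herm_diff_left: "herm (z - z') w = herm z w - herm z' w"
  by (simp add: herm_def algebra_simps)

lemma herm_diff_right: "herm z (w - w') = herm z w - herm z w'"
  by (simp add: herm_def algebra_simps)

lemmas herm_expand = herm_add_left herm_add_right herm_scale_left herm_scale_right
  herm_minus_left herm_minus_right herm_diff_left herm_diff_right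

lemma cmod_herm_commute: "cmod (herm z w) = cmod (herm w z)"
  by (metis cnj_herm complex_mod_cnj)

lemma herm_eq_0_commute: "herm z w = 0 \<longleftrightarrow> herm w z = 0"
  by (metis cnj_herm complex_cnj_zero_iff)

lemma herm_mult_commute: "herm z w * herm w z = of_real ((cmod (herm z w))\<^sup>2)"
  by (metis cnj_herm complex_norm_square)

text \<open>
  The orthogonal complement of a null vector \<open>p\<close> contains \<open>p\<close>, and its quotient by \<open>p\<close> is a positive
  definite line: the horizontal direction of the Heisenberg group of \<open>p\<close>. A coordinate \<open>\<phi>\<close> on this line
  is obtained from Lagrange's identity in the first two coordinates.
\<close>

lemma null_perp_rank_one:
  assumes p: "p \<noteq> 0" "herm p p = 0"
  obtains \<phi> :: "complex^3 \<Rightarrow> complex"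
    where "\<And>v w. herm v p = 0 \<Longrightarrow> herm w p = 0 \<Longrightarrow> herm v w = \<phi> v * cnj (\<phi> w)"
proof
  define \<phi> where "\<phi> v = (v$1 * p$2 - v$2 * p$1) / p$3" for v :: "complex^3"
  have pp: "p$3 * cnj (p$3) = p$1 * cnj (p$1) + p$2 * cnj (p$2)"
    using p(2) by (simp add: herm_def)
  have p3: "p$3 \<noteq> 0"
  proof
    assume "p$3 = 0"
    then have "complex_of_real ((cmod (p$1))\<^sup>2 + (cmod (p$2))\<^sup>2) = 0"
      using p(2) herm_self[of p] by simp
    then have "(cmod (p$1))\<^sup>2 + (cmod (p$2))\<^sup>2 = 0"
      unfolding of_real_eq_0_iff .
    then have "p$1 = 0" "p$2 = 0" by (auto simp: sum_power2_eq_zero_iff)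
    with \<open>p$3 = 0\<close> p(1) show False by (simp add: vec_eq_iff forall_3)
  qed
  show "herm v w = \<phi> v * cnj (\<phi> w)" if "herm v p = 0" "herm w p = 0" for v w
  proof -
    have v: "v$3 * cnj (p$3) = v$1 * cnj (p$1) + v$2 * cnj (p$2)"
      using that(1) by (simp add: herm_def)
    have w: "cnj (w$3) * p$3 = cnj (w$1) * p$1 + cnj (w$2) * p$2"
      using arg_cong[OF that(2), of cnj] by (simp add: herm_def)
    have "herm v w * (p$3 * cnj (p$3))
        = (v$1 * cnj (w$1) + v$2 * cnj (w$2)) * (p$3 * cnj (p$3))
          - (v$3 * cnj (p$3)) * (cnj (w$3) * p$3)"
      by (simp add: herm_def algebra_simps)
    also have "\<dots> = (v$1 * p$2 - v$2 * p$1) * cnj (w$1 * p$2 - w$2 * p$1)"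
      unfolding pp v w by (simp add: algebra_simps)
    finally show ?thesis using p3 by (simp add: \<phi>_def field_simps)
  qed
qed

lemma null_perp_semidefinite:
  assumes p: "p \<noteq> 0" "herm p p = 0" and v: "herm v p = 0" and w: "herm w p = 0"
  shows "0 \<le> Re (herm v v)"
    and "(cmod (herm v w))\<^sup>2 = Re (herm v v) * Re (herm w w)"
proof -
  obtain \<phi> where "\<And>v w. herm v p = 0 \<Longrightarrow> herm w p = 0 \<Longrightarrow> herm v w = \<phi> v * cnj (\<phi> w)"
    using null_perp_rank_one[OF p] by blast
  then have "herm v v = \<phi> v * cnj (\<phi> v)" "herm w w = \<phi> w * cnj (\<phi> w)"
      "herm v w = \<phi> v * cnj (\<phi> w)"
    using v w by auto
  then have "herm v v = of_real ((cmod (\<phi> v))\<^sup>2)" "herm w w = of_real ((cmod (\<phi> w))\<^sup>2)"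
      "cmod (herm v w) = cmod (\<phi> v) * cmod (\<phi> w)"
    by (simp_all add: complex_norm_square norm_mult flip: of_real_power)
  then show "0 \<le> Re (herm v v)"
    and "(cmod (herm v w))\<^sup>2 = Re (herm v v) * Re (herm w w)"
    by (simp_all add: power_mult_distrib)
qed

text \<open>
  This is the triangle inequality of the extended Cygan metric of \<open>p\<close>. The vectors \<open>q\<close>, \<open>q'\<close> and
  \<open>y\<close>, a multiple of \<open>z\<close>, are scaled to have the same product with \<open>p\<close>, so that their differences lie
  in the semidefinite complement of \<open>p\<close>. Expanding \<open>\<langle>q, q'\<rangle>\<close> around \<open>y\<close> produces the two products
  \<open>\<langle>q, y\<rangle>\<close> and \<open>\<langle>y, q'\<rangle>\<close>, the height \<open>h = - \<langle>y, y\<rangle>\<close> and \<open>\<langle>q - y, q' - y\<rangle>\<close>. Cauchy-Schwarz bounds the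
  last one by \<open>2 \<kappa> - h\<close>, and the height cancels.
\<close>

lemma isometric_balls_disjoint:
  assumes p: "p \<noteq> 0" "herm p p = 0"
    and q: "herm q q = 0" "herm q p = of_real \<kappa>"
    and q': "herm q' q' = 0" "herm q' p = of_real \<kappa>"
    and \<kappa>: "0 < \<kappa>" and z: "Re (herm z z) \<le> 0"
    and le: "cmod (herm z q) \<le> cmod (herm z p)"
    and less: "cmod (herm z q') < cmod (herm z p)"
  shows "cmod (herm q q') < 4 * \<kappa>"
proof -
  define k where "k = of_real \<kappa> / herm z p"
  define y where "y = k *s z"
  define h where "h = - Re (herm y y)"
  have zp: "herm z p \<noteq> 0" using less by auto
  have yp: "herm y p = of_real \<kappa>" using zp by (simp add: y_def k_def herm_scale_left)
  have ck: "cmod k * cmod (herm z p) = \<kappa>"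
    using zp \<kappa> by (simp add: k_def norm_divide)
  have "k \<noteq> 0" using ck \<kappa> by auto
  have yq: "cmod (herm y q) \<le> \<kappa>"
    unfolding y_def herm_scale_left norm_mult ck[symmetric] using le by (simp add: mult_left_mono)
  have yq': "cmod (herm y q') < \<kappa>"
    unfolding y_def herm_scale_left norm_mult ck[symmetric] using less \<open>k \<noteq> 0\<close> by simp
  have "herm y y = of_real ((cmod k)\<^sup>2) * herm z z"
    by (simp add: y_def herm_scale_left herm_scale_right complex_norm_square del: of_real_power)
  then have h0: "0 \<le> h" using z by (simp add: h_def mult_nonneg_nonpos)
  have yy: "herm y y = - of_real h"
    by (subst herm_self_of_real) (simp add: h_def)
  define a where "a = q - y"
  define b where "b = q' - y"
  have ap: "herm a p = 0" and bp: "herm b p = 0"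
    by (simp_all add: a_def b_def herm_diff_left q q' yp)
  have "herm a a = - of_real h - herm q y - herm y q"
    by (simp add: a_def herm_expand q yy)
  then have "Re (herm a a) = - h - 2 * Re (herm y q)"
    using cnj_herm[of y q] by (simp add: complex_eq_iff)
  then have a: "Re (herm a a) \<le> 2 * \<kappa> - h"
    using yq abs_Re_le_cmod[of "herm y q"] by linarith
  have "herm b b = - of_real h - herm q' y - herm y q'"
    by (simp add: b_def herm_expand q' yy)
  then have "Re (herm b b) = - h - 2 * Re (herm y q')"
    using cnj_herm[of y q'] by (simp add: complex_eq_iff)
  then have b: "Re (herm b b) \<le> 2 * \<kappa> - h"
    using yq' abs_Re_le_cmod[of "herm y q'"] by linarith
  have a0: "0 \<le> Re (herm a a)" and b0: "0 \<le> Re (herm b b)"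
    using null_perp_semidefinite(1)[OF p] ap bp by blast+
  have "(cmod (herm a b))\<^sup>2 = Re (herm a a) * Re (herm b b)"
    using null_perp_semidefinite(2)[OF p ap bp] .
  also have "\<dots> \<le> (2 * \<kappa> - h)\<^sup>2"
    unfolding power2_eq_square using a b a0 b0 by (intro mult_mono) auto
  finally have ab: "cmod (herm a b) \<le> 2 * \<kappa> - h"
    using a a0 by (auto intro: power2_le_imp_le)
  have "herm q q' = herm q y + herm y q' + of_real h + herm a b"
    by (simp add: a_def b_def herm_expand yy)
  also have "cmod \<dots> \<le> cmod (herm q y) + cmod (herm y q') + h + cmod (herm a b)"
    using h0 by (intro order.trans[OF norm_triangle_ineq] add_mono order.refl) auto
  finally show ?thesis
    using yq yq' ab cmod_herm_commute[of q y] by linarith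
qed

text \<open>
  An isometric ball does not reach into a high horoball based at \<open>p\<close>: if \<open>q\<close> and \<open>z\<close> are scaled to
  have equal products with \<open>p\<close>, then positivity of \<open>\<langle>q - z, q - z\<rangle>\<close> bounds \<open>\<bar>\<langle>z, q\<rangle>\<bar>\<close> from below by half of the
  height of \<open>z\<close>.
\<close>

lemma isometric_ball_below_horoball:
  assumes p: "p \<noteq> 0" "herm p p = 0"
    and q: "herm q q = 0" "herm q p = of_real \<kappa>" and \<kappa>: "0 < \<kappa>"
    and z: "2 * (cmod (herm z p))\<^sup>2 < - Re (herm z z) * \<kappa>"
  shows "cmod (herm z p) < cmod (herm z q)"
proof -
  have zneg: "Re (herm z z) < 0"
  proof -
    have "0 < - Re (herm z z) * \<kappa>" using z zero_le_power2[of "cmod (herm z p)"] by linarith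
    then show ?thesis using \<kappa> by (simp add: mult_less_0_iff)
  qed
  have zp: "herm z p \<noteq> 0"
    using null_perp_semidefinite(1)[OF p, of z z] zneg by auto
  define k where "k = of_real \<kappa> / herm z p"
  define y where "y = k *s z"
  have yp: "herm y p = of_real \<kappa>" using zp by (simp add: y_def k_def herm_scale_left)
  have ck: "cmod k * cmod (herm z p) = \<kappa>"
    using zp \<kappa> by (simp add: k_def norm_divide)
  have "k \<noteq> 0" using ck \<kappa> by auto
  have "herm y y = of_real ((cmod k)\<^sup>2) * herm z z"
    by (simp add: y_def herm_scale_left herm_scale_right complex_norm_square del: of_real_power)
  then have "- Re (herm y y) * \<kappa> = (cmod k)\<^sup>2 * (- Re (herm z z) * \<kappa>)"
    by simp
  also have "\<dots> > (cmod k)\<^sup>2 * (2 * (cmod (herm z p))\<^sup>2)"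
    using z \<open>k \<noteq> 0\<close> by (intro mult_strict_left_mono) auto
  also have "(cmod k)\<^sup>2 * (2 * (cmod (herm z p))\<^sup>2) = 2 * \<kappa> * \<kappa>"
    by (simp add: ck[symmetric] power2_eq_square)
  finally have yy: "2 * \<kappa> < - Re (herm y y)"
    using \<kappa> by (simp only: mult_less_cancel_right_pos)
  have "herm (q - y) p = 0" by (simp add: herm_diff_left q yp)
  then have "0 \<le> Re (herm (q - y) (q - y))" using null_perp_semidefinite(1)[OF p] by blast
  also have "herm (q - y) (q - y) = herm y y - herm q y - herm y q"
    by (simp add: herm_expand q)
  also have "Re (herm y y - herm q y - herm y q) = Re (herm y y) - 2 * Re (herm y q)"
    using cnj_herm[of y q] by (simp add: complex_eq_iff)
  finally have "\<kappa> < cmod (herm y q)"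
    using yy abs_Re_le_cmod[of "herm y q"] by linarith
  then have "cmod k * cmod (herm z p) < cmod k * cmod (herm z q)"
    unfolding ck by (simp add: y_def herm_scale_left norm_mult)
  then show ?thesis using \<open>k \<noteq> 0\<close> by simp
qed

text \<open>
  The witness is the Hermitian cross product of \<open>c\<close> and \<open>d\<close>.
\<close>

lemma common_perpendicular:
  obtains z where "herm z c = 0" "herm z d = 0"
    "herm z z = of_real ((cmod (herm c d))\<^sup>2) - herm c c * herm d d"
proof
  define z :: "complex^3" where "z = vector
    [cnj (c$3) * cnj (d$2) - cnj (c$2) * cnj (d$3),
     cnj (c$1) * cnj (d$3) - cnj (c$3) * cnj (d$1),
     cnj (c$1) * cnj (d$2) - cnj (c$2) * cnj (d$1)]"
  show "herm z c = 0" "herm z d = 0"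
    by (simp_all add: z_def herm_def vector_3 algebra_simps)
  show "herm z z = of_real ((cmod (herm c d))\<^sup>2) - herm c c * herm d d"
    unfolding herm_mult_commute[symmetric]
    unfolding z_def herm_def vector_3 complex_cnj_diff complex_cnj_mult complex_cnj_cnj
    by algebra
qed

section \<open>The distance between complex geodesics\<close>

lemma proj_line_in_geodesic:
  assumes C: "polar_vector C c" and z: "z \<noteq> 0"
  shows "proj_line z \<in> C \<longleftrightarrow> herm z c = 0"
proof
  assume "proj_line z \<in> C"
  then obtain w where w: "w \<noteq> 0" "herm c w = 0" "proj_line w = proj_line z"
    using C by (auto simp: polar_vector_def)
  then obtain k where "z = k *s w" using proj_line_eqE z by metis
  then have "herm c z = 0" using w by (simp add: herm_scale_right)
  then show "herm z c = 0" by (simp add: herm_eq_0_commute)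
next
  assume "herm z c = 0"
  then have "herm c z = 0" by (simp add: herm_eq_0_commute)
  then show "proj_line z \<in> C" using C z by (auto simp: polar_vector_def)
qed

lemma geodesic_hyp_plane:
  assumes "polar_vector C c"
  shows "C \<inter> hyp_plane = {proj_line z |z. Re (herm z z) < 0 \<and> herm z c = 0}"
proof -
  have "z \<noteq> 0" if "Re (herm z z) < 0" for z using that by auto
  then show ?thesis
    using proj_line_in_geodesic[OF assms] by (auto simp: hyp_plane_def)
qed

lemma bergman_dist_negative:
  assumes z: "Re (herm z z) < 0" and w: "Re (herm w w) < 0"
  shows "bergman_dist (proj_line z) (proj_line w)
    = 2 * arcosh (cmod (herm z w) / sqrt (Re (herm z z) * Re (herm w w)))"
proof -
  let ?d = "bergman_dist (proj_line z) (proj_line w)"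
  have pos: "0 < Re (herm z z) * Re (herm w w)" using z w by (rule mult_neg_neg)
  have "complex_of_real ((cosh (?d / 2))\<^sup>2)
      = of_real ((cmod (herm z w))\<^sup>2 / (Re (herm z z) * Re (herm w w)))"
    unfolding cosh_bergman_dist(2)[OF z w] herm_mult_commute
    by (simp flip: herm_self_of_real)
  then have "(cosh (?d / 2))\<^sup>2 = (cmod (herm z w) / sqrt (Re (herm z z) * Re (herm w w)))\<^sup>2"
    using pos unfolding of_real_eq_iff by (simp add: power_divide)
  then have "cosh (?d / 2) = cmod (herm z w) / sqrt (Re (herm z z) * Re (herm w w))"
    using pos by (subst (asm) power2_eq_iff_nonneg) (auto simp: cosh_real_nonneg)
  then show ?thesis
    using cosh_bergman_dist(1)[OF z w] arcosh_cosh_real[of "?d / 2"] by simp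
qed

lemma arcosh_real_mono: "1 \<le> x \<Longrightarrow> x \<le> y \<Longrightarrow> arcosh x \<le> arcosh (y :: real)"
  using arcosh_less_iff_real[of y x] by linarith

text \<open>
  Removing from \<open>w\<close> its component along \<open>c\<close> does not change \<open>\<langle>z, w\<rangle>\<close>, and the reversed Cauchy-Schwarz
  inequality applies to the rest. This lowers \<open>\<langle>w, w\<rangle>\<close> by \<open>\<bar>\<langle>w, c\<rangle>\<bar>\<^sup>2\<close>, which the
  same inequality, now for \<open>w\<close> and the component of \<open>c\<close> orthogonal to \<open>d\<close>, bounds from below.
\<close>

lemma geodesic_separation:
  assumes c: "herm c c = 1" and d: "herm d d = 1" and t: "1 \<le> cmod (herm c d)"
    and z: "Re (herm z z) < 0" "herm z c = 0" and w: "Re (herm w w) < 0" "herm w d = 0"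
  shows "(cmod (herm c d))\<^sup>2 * (Re (herm z z) * Re (herm w w)) \<le> (cmod (herm z w))\<^sup>2"
proof -
  define T where "T = (cmod (herm c d))\<^sup>2"
  have T1: "1 \<le> T" using t by (simp add: T_def)
  define e where "e = herm w c"
  define v where "v = w - e *s c"
  define u where "u = c - herm c d *s d"
  have zv: "herm z v = herm z w" by (simp add: v_def herm_expand z)
  have "herm v v = herm w w - of_real ((cmod e)\<^sup>2)"
    by (simp add: v_def herm_expand c e_def complex_norm_square cnj_herm algebra_simps
        del: of_real_power)
  then have vv: "Re (herm v v) = Re (herm w w) - (cmod e)\<^sup>2" by simp
  then have "Re (herm v v) < 0" using w zero_le_power2[of "cmod e"] by linarith
  then have 1: "Re (herm z z) * Re (herm v v) \<le> (cmod (herm z w))\<^sup>2"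
    using reversed_Cauchy_Schwarz[OF z(1)] zv by metis
  have "herm u u = 1 - of_real T"
    by (simp add: u_def herm_expand c d T_def complex_norm_square cnj_herm algebra_simps
        del: of_real_power)
  then have uu: "Re (herm u u) = 1 - T" by simp
  have wu: "herm w u = e" by (simp add: u_def herm_expand w e_def)
  have 2: "Re (herm w w) * (1 - T) \<le> (cmod e)\<^sup>2"
  proof (cases "T = 1")
    case False
    then show ?thesis
      using reversed_Cauchy_Schwarz[OF w(1), of u] T1 by (simp add: uu wu)
  qed auto
  have "Re (herm v v) \<le> T * Re (herm w w)"
    using 2 vv by (simp add: algebra_simps)
  then have "Re (herm z z) * (T * Re (herm w w)) \<le> Re (herm z z) * Re (herm v v)"
    using z by (intro mult_left_mono_neg) auto
  then show ?thesis using 1 by (simp add: T_def mult_ac)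
qed

text \<open>
  So a complex geodesic has a point in the hyperbolic plane: the third basis vector, projected along \<open>d\<close>.
\<close>

lemma exists_negative_perp:
  assumes "herm d d = 1"
  obtains v where "Re (herm v v) < 0" "herm v d = 0"
proof
  define e :: "complex^3" where "e = axis 3 1"
  define v where "v = e - herm e d *s d"
  have ee: "herm e e = - 1" by (simp add: e_def herm_def axis_def)
  show "herm v d = 0" by (simp add: v_def herm_expand assms)
  have "herm v v = - 1 - of_real ((cmod (herm e d))\<^sup>2)"
    by (simp add: v_def herm_expand assms ee complex_norm_square cnj_herm algebra_simps
        del: of_real_power)
  then show "Re (herm v v) < 0" by (simp add: order.strict_trans2[OF _ zero_le_power2])
qed

text \<open>
  For ultra-parallel geodesics equality in the previous bound is attained at the component \<open>u\<close> of \<open>c\<close>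
  orthogonal to \<open>d\<close> and its projection along \<open>c\<close>. If \<open>\<bar>\<langle>c, d\<rangle>\<bar> = 1\<close>, then \<open>u\<close> is null or zero and the
  infimum need not be attained. Moving \<open>u\<close> slightly into the hyperbolic plane by a negative vector \<open>v\<close>
  treats both cases at once.
\<close>

lemma geodesic_separation_sharp:
  assumes c: "herm c c = 1" and d: "herm d d = 1" and t: "1 \<le> cmod (herm c d)"
    and B: "cmod (herm c d) < B"
  obtains z w where "Re (herm z z) < 0" "herm z c = 0" "Re (herm w w) < 0" "herm w d = 0"
    "(cmod (herm z w))\<^sup>2 \<le> B\<^sup>2 * (Re (herm z z) * Re (herm w w))"
proof -
  define a where "a = (cmod (herm c d))\<^sup>2 - 1"
  define \<beta> where "\<beta> = B\<^sup>2 - 1"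
  have "1\<^sup>2 \<le> (cmod (herm c d))\<^sup>2" "(cmod (herm c d))\<^sup>2 < B\<^sup>2"
    using t B by (auto intro!: power_mono power_strict_mono simp del: one_power2)
  then have a0: "0 \<le> a" and a\<beta>: "a < \<beta>" by (auto simp: a_def \<beta>_def)
  define u where "u = c - herm c d *s d"
  have ud: "herm u d = 0" by (simp add: u_def herm_expand d)
  have uu: "herm u u = - of_real a"
    by (simp add: u_def herm_expand c d a_def complex_norm_square cnj_herm algebra_simps
        del: of_real_power)
  obtain v0 where v0: "Re (herm v0 v0) < 0" "herm v0 d = 0" using exists_negative_perp[OF d] .
  define s where "s = herm u v0"
  \<comment> \<open>A phase that makes \<open>\<langle>u, v\<rangle>\<close> real and nonpositive, so that the length of \<open>u + \<epsilon> v\<close> is negative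
    for all \<open>\<epsilon> > 0\<close>.\<close>
  define \<theta> where "\<theta> = (if s = 0 then 1 else - s / of_real (cmod s))"
  have th1: "cmod \<theta> = 1" and th2: "cnj \<theta> * s = - of_real (cmod s)"
    using complex_norm_square[of s]
    by (auto simp: \<theta>_def norm_divide power2_eq_square field_simps)
  define v where "v = \<theta> *s v0"
  define k where "k = cmod s"
  have k0: "0 \<le> k" by (simp add: k_def)
  have vd: "herm v d = 0" by (simp add: v_def herm_expand v0)
  have uv: "herm u v = - of_real k" using th2 by (simp add: v_def herm_expand s_def k_def)
  have vu: "herm v u = - of_real k" using cnj_herm[of u v] uv by simp
  have "herm v v = of_real ((cmod \<theta>)\<^sup>2) * herm v0 v0"
    by (simp add: v_def herm_expand complex_norm_square del: of_real_power)
  then have vv: "Re (herm v v) < 0" using v0 th1 by simp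
  define n where "n = - Re (herm v v)"
  have vvn: "herm v v = - of_real n" by (subst herm_self_of_real) (simp add: n_def)
  \<comment> \<open>Small enough for \<open>\<epsilon> k \<le> \<beta> - a\<close>, whatever \<open>k \<ge> 0\<close> is.\<close>
  define \<epsilon> where "\<epsilon> = (\<beta> - a) / (k + 1)"
  have e0: "0 < \<epsilon>" using a\<beta> k0 by (simp add: \<epsilon>_def)
  have ek: "\<epsilon> * k \<le> \<beta> - a"
  proof -
    have "\<epsilon> * k \<le> \<epsilon> * (k + 1)" using e0 by simp
    also have "\<dots> = \<beta> - a" using k0 by (simp add: \<epsilon>_def)
    finally show ?thesis .
  qed
  define w where "w = u + of_real \<epsilon> *s v"
  define N where "N = a + 2 * \<epsilon> * k + \<epsilon>\<^sup>2 * n"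
  have wd: "herm w d = 0" by (simp add: w_def herm_expand ud vd)
  have ww: "herm w w = - of_real N"
    by (simp add: w_def herm_expand uu uv vu vvn N_def power2_eq_square algebra_simps)
  have "0 < \<epsilon>\<^sup>2 * n" using e0 vv by (simp add: n_def mult_pos_neg)
  moreover have "0 \<le> \<epsilon> * k" using e0 k0 by simp
  ultimately have N0: "0 < N" and Nge: "a + 2 * \<epsilon> * k \<le> N" using a0 by (auto simp: N_def)
  have "herm w c = herm w u"
    by (simp add: u_def herm_expand wd)
  also have "\<dots> = - of_real (a + \<epsilon> * k)"
    by (simp add: w_def herm_expand uu vu)
  finally have wc: "herm w c = - of_real (a + \<epsilon> * k)" .
  define E where "E = (a + \<epsilon> * k)\<^sup>2"
  have "E \<le> \<beta> * (a + 2 * \<epsilon> * k)"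
  proof -
    have "E = a * a + (\<epsilon> * k) * (2 * a + \<epsilon> * k)" by (simp add: E_def power2_eq_square algebra_simps)
    also have "\<dots> \<le> \<beta> * a + (\<epsilon> * k) * (2 * \<beta>)"
      using a\<beta> a0 ek e0 k0 by (intro add_mono mult_mono mult_left_mono) auto
    finally show ?thesis by (simp add: algebra_simps)
  qed
  also have "\<dots> \<le> \<beta> * N" using Nge a\<beta> a0 by (intro mult_left_mono) auto
  finally have EN: "E \<le> \<beta> * N" .
  define z where "z = w - herm w c *s c"
  have zc: "herm z c = 0" by (simp add: z_def herm_expand c)
  have cw: "herm c w = - of_real (a + \<epsilon> * k)" using cnj_herm[of w c] wc by simp
  have zw: "herm z w = - of_real (N + E)"
    by (simp add: z_def herm_expand ww wc cw E_def power2_eq_square algebra_simps)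
  have zz: "herm z z = - of_real (N + E)"
    by (simp add: z_def herm_expand ww wc cw c E_def power2_eq_square algebra_simps)
  have E0: "0 \<le> E" by (simp add: E_def)
  show thesis
  proof
    show "Re (herm z z) < 0" "herm z c = 0" "Re (herm w w) < 0" "herm w d = 0"
      using zc wd N0 E0 by (simp_all add: zz ww)
    have "N + E \<le> B\<^sup>2 * N" using EN by (simp add: \<beta>_def algebra_simps)
    then have "(N + E) * (N + E) \<le> (N + E) * (B\<^sup>2 * N)"
      using N0 E0 by (intro mult_left_mono) auto
    moreover have "cmod (herm z w) = N + E" unfolding zw norm_minus_cancel norm_of_real using N0 E0 by simp
    ultimately show "(cmod (herm z w))\<^sup>2 \<le> B\<^sup>2 * (Re (herm z z) * Re (herm w w))"
      by (simp add: zz ww power2_eq_square algebra_simps)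
  qed
qed

lemma geodesic_dist_eq_arcosh:
  assumes C: "normalised_polar_vector C c" and D: "normalised_polar_vector D d"
    and t: "1 \<le> cmod (herm c d)"
  shows "geodesic_dist C D = 2 * arcosh (cmod (herm c d))"
proof -
  define t where "t = cmod (herm c d)"
  have c: "polar_vector C c" "herm c c = 1" and d: "polar_vector D d" "herm d d = 1"
    using C D by (auto simp: normalised_polar_vector_def)
  let ?S = "(C \<inter> hyp_plane) \<times> (D \<inter> hyp_plane)"
  have lower: "2 * arcosh t \<le> bergman_dist x y" if "(x, y) \<in> ?S" for x y
  proof -
    obtain z where z: "x = proj_line z" "Re (herm z z) < 0" "herm z c = 0"
      using \<open>(x, y) \<in> ?S\<close> unfolding geodesic_hyp_plane[OF c(1)] by auto
    obtain w where w: "y = proj_line w" "Re (herm w w) < 0" "herm w d = 0"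
      using \<open>(x, y) \<in> ?S\<close> unfolding geodesic_hyp_plane[OF d(1)] by auto
    have pos: "0 < Re (herm z z) * Re (herm w w)" using z w by (intro mult_neg_neg)
    have "t \<le> cmod (herm z w) / sqrt (Re (herm z z) * Re (herm w w))"
    proof (rule power2_le_imp_le)
      show "t\<^sup>2 \<le> (cmod (herm z w) / sqrt (Re (herm z z) * Re (herm w w)))\<^sup>2"
        using geodesic_separation[OF c(2) d(2) t z(2,3) w(2,3)] pos
        by (simp add: t_def power_divide le_divide_eq)
    qed (use pos in auto)
    then have "arcosh t \<le> arcosh (cmod (herm z w) / sqrt (Re (herm z z) * Re (herm w w)))"
      using t by (intro arcosh_real_mono) (auto simp: t_def)
    then show ?thesis unfolding z(1) w(1) bergman_dist_negative[OF z(2) w(2)] by simp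
  qed
  then have bdd: "bdd_below ((\<lambda>(x, y). bergman_dist x y) ` ?S)"
    by (intro bdd_belowI[of _ "2 * arcosh t"]) auto
  have upper: "geodesic_dist C D \<le> 2 * arcosh B" if "t < B" for B
  proof -
    obtain z w where z: "Re (herm z z) < 0" "herm z c = 0" and w: "Re (herm w w) < 0" "herm w d = 0"
      and zw: "(cmod (herm z w))\<^sup>2 \<le> B\<^sup>2 * (Re (herm z z) * Re (herm w w))"
      using geodesic_separation_sharp[OF c(2) d(2) t \<open>t < B\<close>[unfolded t_def]] .
    have pos: "0 < Re (herm z z) * Re (herm w w)" using z w by (intro mult_neg_neg)
    have in_S: "(proj_line z, proj_line w) \<in> ?S"
      unfolding geodesic_hyp_plane[OF c(1)] geodesic_hyp_plane[OF d(1)] using z w by auto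
    have "cmod (herm z w) / sqrt (Re (herm z z) * Re (herm w w)) \<le> B"
    proof (rule power2_le_imp_le)
      show "(cmod (herm z w) / sqrt (Re (herm z z) * Re (herm w w)))\<^sup>2 \<le> B\<^sup>2"
        using zw pos by (simp add: power_divide divide_le_eq)
    qed (use that t in \<open>auto simp: t_def\<close>)
    moreover have "1 \<le> cmod (herm z w) / sqrt (Re (herm z z) * Re (herm w w))"
      using real_sqrt_le_mono[OF reversed_Cauchy_Schwarz[OF z(1) w(1)]] pos
      by (simp add: le_divide_eq)
    ultimately have "arcosh (cmod (herm z w) / sqrt (Re (herm z z) * Re (herm w w))) \<le> arcosh B"
      by (rule arcosh_real_mono[rotated])
    then have "bergman_dist (proj_line z) (proj_line w) \<le> 2 * arcosh B"
      unfolding bergman_dist_negative[OF z(1) w(1)] by simp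
    moreover have "geodesic_dist C D \<le> bergman_dist (proj_line z) (proj_line w)"
      unfolding geodesic_dist_def using cINF_lower[OF bdd in_S] by simp
    ultimately show ?thesis by simp
  qed
  have "2 * arcosh t \<le> geodesic_dist C D"
    unfolding geodesic_dist_def
  proof (rule cINF_greatest)
    obtain z where "Re (herm z z) < 0" "herm z c = 0" using exists_negative_perp[OF c(2)] .
    moreover obtain w where "Re (herm w w) < 0" "herm w d = 0" using exists_negative_perp[OF d(2)] .
    ultimately show "?S \<noteq> {}"
      unfolding geodesic_hyp_plane[OF c(1)] geodesic_hyp_plane[OF d(1)] by auto
  qed (use lower in auto)
  moreover have "\<not> 2 * arcosh t < geodesic_dist C D"
  proof
    assume less: "2 * arcosh t < geodesic_dist C D"
    define B where "B = cosh ((2 * arcosh t + geodesic_dist C D) / 4)"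
    have nn: "0 \<le> arcosh t" using t by (simp add: t_def)
    have "cosh (arcosh t) < B"
      unfolding B_def using less nn by (subst cosh_real_strict_mono) auto
    then have "t < B" using t by (simp add: t_def)
    then have "geodesic_dist C D \<le> 2 * arcosh B" by (rule upper)
    also have "\<dots> = (2 * arcosh t + geodesic_dist C D) / 2"
      unfolding B_def using less nn by (subst arcosh_cosh_real) auto
    finally show False using less by simp
  qed
  ultimately show ?thesis by (simp add: t_def)
qed

text \<open>
  If \<open>\<bar>\<langle>c, d\<rangle>\<bar> < 1\<close>, the common perpendicular of \<open>c\<close> and \<open>d\<close> is negative, and the geodesics meet in the
  hyperbolic plane. For an ideal pair both polar vectors are orthogonal to the common null vector, where
  the form has rank one and Cauchy-Schwarz is an equality.
\<close>

lemma ultra_parallel_or_ideal_cmod_herm: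
  assumes C: "normalised_polar_vector C c" and D: "normalised_polar_vector D d"
    and CD: "ultra_parallel C D \<or> ideal_pair C D"
  shows "1 \<le> cmod (herm c d)"
  using CD
proof
  have c: "polar_vector C c" "herm c c = 1" and d: "polar_vector D d" "herm d d = 1"
    using C D by (auto simp: normalised_polar_vector_def)
  {
    assume up: "ultra_parallel C D"
    show ?thesis
    proof (rule ccontr)
      assume "\<not> ?thesis"
      then have "(cmod (herm c d))\<^sup>2 < 1" by (simp add: power_less_one_iff)
      moreover obtain z where z: "herm z c = 0" "herm z d = 0"
          "herm z z = of_real ((cmod (herm c d))\<^sup>2) - herm c c * herm d d"
        by (rule common_perpendicular)
      ultimately have "Re (herm z z) < 0" using c d by simp
      then have "proj_line z \<in> (C \<inter> hyp_plane) \<inter> (D \<inter> hyp_plane)"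
        unfolding geodesic_hyp_plane[OF c(1)] geodesic_hyp_plane[OF d(1)] using z by auto
      then show False using up by (auto simp: ultra_parallel_def)
    qed
  next
    assume "ideal_pair C D"
    then obtain z where z: "z \<noteq> 0" "herm z z = 0" "proj_line z \<in> C" "proj_line z \<in> D"
      by (auto simp: ideal_pair_def hyp_boundary_def)
    then have "herm c z = 0" "herm d z = 0"
      using proj_line_in_geodesic c d herm_eq_0_commute by metis+
    then have "(cmod (herm c d))\<^sup>2 = 1"
      using null_perp_semidefinite(2)[OF z(1,2)] c d by fastforce
    then have "cmod (herm c d) = 1 \<or> cmod (herm c d) = - 1" by (simp add: power2_eq_1_iff)
    then show ?thesis using norm_ge_zero[of "herm c d"] by linarith
  }
qed

section \<open>Discreteness in the projective unitary group\<close>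

lemma U21_simps: "mult U21 = (**)" "one U21 = mat 1"
  by (simp_all add: U21_def)

lemma herm_U21: "X \<in> carrier U21 \<Longrightarrow> herm (X *v z) (X *v w) = herm z w"
  by (simp add: U21_def)

lemma U21_mult_closed: "X \<in> carrier U21 \<Longrightarrow> Y \<in> carrier U21 \<Longrightarrow> X ** Y \<in> carrier U21"
  using monoid.m_closed[OF group.is_monoid[OF group_U21]] by (simp add: U21_simps)

lemma U21_one_closed: "mat 1 \<in> carrier U21"
  using monoid.one_closed[OF group.is_monoid[OF group_U21]] by (simp add: U21_simps)

lemma unit_scalars_subset: "unit_scalars \<subseteq> carrier U21"
  using unit_scalars_normal by (simp add: normal_def subgroup.subset)

lemma proj_class_mult:
  "X \<in> carrier U21 \<Longrightarrow> Y \<in> carrier U21 \<Longrightarrow>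
    proj_class X \<otimes>\<^bsub>PU21\<^esub> proj_class Y = proj_class (X ** Y)"
  using normal.rcos_sum[OF unit_scalars_normal]
  by (simp add: proj_class_def PU21_def FactGroup_def U21_simps)

lemma proj_class_one: "proj_class (mat 1) = \<one>\<^bsub>PU21\<^esub>"
  using group.coset_mult_one[OF group_U21 unit_scalars_subset]
  by (simp add: proj_class_def PU21_def FactGroup_def U21_simps)

lemma proj_class_scale:
  assumes "X \<in> carrier U21" "cmod k = 1"
  shows "proj_class (mat k ** X) = proj_class X"
proof -
  have "mat k \<in> unit_scalars" using assms by (auto simp: unit_scalars_def)
  then have "mat k ** X \<in> unit_scalars #>\<^bsub>U21\<^esub> X"
    by (auto simp: r_coset_def U21_simps)
  then show ?thesis
    unfolding proj_class_def
    using group.repr_independence[OF group_U21] assms(1) unit_scalars_normal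
    by (metis normal_imp_subgroup)
qed

lemma proj_class_eqE:
  assumes "X \<in> carrier U21" "proj_class X = proj_class Y"
  obtains k where "cmod k = 1" "X = mat k ** Y"
proof -
  have "X \<in> proj_class X"
    unfolding proj_class_def
    using group.rcos_self[OF group_U21 assms(1) normal_imp_subgroup[OF unit_scalars_normal]] .
  then show ?thesis
    using that unfolding assms(2) by (auto simp: proj_class_def r_coset_def unit_scalars_def U21_simps)
qed

lemma topspace_PU21: "topspace PU21_topology = carrier PU21"
  using quotient_map_proj_class by (simp add: quotient_map_def carrier_PU21)

text \<open>
  A neighbourhood of the identity in \<open>U(2,1)\<close> that is invariant under unit scalars is the preimage of a
  neighbourhood of the identity in \<open>PU(2,1)\<close>. Translating it to \<open>\<gamma>\<close> isolates \<open>\<gamma>\<close> in \<open>\<Gamma>\<close>.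
\<close>

lemma discrete_subgroupI:
  assumes \<Gamma>: "subgroup \<Gamma> PU21"
    and N: "openin (top_of_set (carrier U21)) N" "mat 1 \<in> N"
    and scale: "\<And>X k. X \<in> N \<Longrightarrow> cmod k = 1 \<Longrightarrow> mat k ** X \<in> N"
    and isolated: "\<And>X. X \<in> N \<Longrightarrow> proj_class X \<in> \<Gamma> \<Longrightarrow> proj_class X = \<one>\<^bsub>PU21\<^esub>"
  shows "discrete_subgroup \<Gamma>"
proof -
  interpret PU: group PU21 by (rule group_PU21)
  interpret U: group U21 by (rule group_U21)
  have \<Gamma>_sub: "\<Gamma> \<subseteq> carrier PU21" using \<Gamma> by (rule subgroup.subset)
  have NU: "N \<subseteq> carrier U21" using openin_subset[OF N(1)] by simp
  have "openin (subtopology PU21_topology \<Gamma>) {\<gamma>}" if \<gamma>: "\<gamma> \<in> \<Gamma>" for \<gamma>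
  proof -
    obtain G where G: "G \<in> carrier U21" "\<gamma> = proj_class G"
      using \<gamma> \<Gamma>_sub by (auto simp: carrier_PU21)
    define B where "B = inv\<^bsub>U21\<^esub> G"
    have B: "B \<in> carrier U21" "B ** G = mat 1" "G ** B = mat 1"
      using U.inv_closed[OF G(1)] U.l_inv[OF G(1)] U.r_inv[OF G(1)] by (simp_all add: B_def U21_simps)
    have "proj_class B = inv\<^bsub>PU21\<^esub> \<gamma>"
      using proj_class_mult[OF B(1) G(1)] B G \<gamma> \<Gamma>_sub
      by (intro PU.inv_equality[symmetric]) (auto simp: proj_class_one carrier_PU21)
    then have B\<Gamma>: "proj_class B \<in> \<Gamma>" using subgroup.m_inv_closed[OF \<Gamma> \<gamma>] by simp
    define M where "M = {X \<in> carrier U21. B ** X \<in> N}"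
    define W where "W = proj_class ` M"
    have M_saturated: "{A \<in> carrier U21. proj_class A \<in> W} = M"
    proof
      show "{A \<in> carrier U21. proj_class A \<in> W} \<subseteq> M"
      proof
        fix A assume "A \<in> {A \<in> carrier U21. proj_class A \<in> W}"
        then obtain X where A: "A \<in> carrier U21" and X: "X \<in> M" "proj_class A = proj_class X"
          by (auto simp: W_def)
        obtain k where k: "cmod k = 1" "A = mat k ** X" using proj_class_eqE A X by metis
        have "B ** A = mat k ** (B ** X)"
          unfolding k matrix_mul_assoc by (simp add: mat_matrix_mult matrix_mult_mat)
        then show "A \<in> M" using scale k(1) X A by (simp add: M_def)
      qed
    qed (auto simp: W_def M_def)
    have "continuous_on (carrier U21) (\<lambda>X. B ** X)"
      unfolding matrix_matrix_mult_def by (intro continuous_intros)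
    moreover have "(\<lambda>X. B ** X) \<in> carrier U21 \<rightarrow> carrier U21" using B U21_mult_closed by auto
    ultimately have "openin (top_of_set (carrier U21)) (carrier U21 \<inter> (\<lambda>X. B ** X) -` N)"
      using N(1) by (rule continuous_openin_preimage)
    also have "carrier U21 \<inter> (\<lambda>X. B ** X) -` N = M" by (auto simp: M_def)
    finally have "openin PU21_topology W"
      unfolding openin_PU21_topology M_saturated by (auto simp: W_def M_def carrier_PU21)
    moreover have "W \<inter> \<Gamma> = {\<gamma>}"
    proof
      show "W \<inter> \<Gamma> \<subseteq> {\<gamma>}"
      proof
        fix x assume "x \<in> W \<inter> \<Gamma>"
        then obtain X where X: "x = proj_class X" "X \<in> carrier U21" "B ** X \<in> N" "proj_class X \<in> \<Gamma>"
          by (auto simp: W_def M_def)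
        have "proj_class (B ** X) \<in> \<Gamma>"
          using subgroup.m_closed[OF \<Gamma> B\<Gamma> X(4)] X B by (simp add: proj_class_mult)
        then have "proj_class (B ** X) = \<one>\<^bsub>PU21\<^esub>" using isolated X by blast
        moreover have "X = G ** (B ** X)" using B by (simp add: matrix_mul_assoc)
        ultimately have "x = \<gamma> \<otimes>\<^bsub>PU21\<^esub> \<one>\<^bsub>PU21\<^esub>"
          using X G B proj_class_mult U21_mult_closed by metis
        then show "x \<in> {\<gamma>}" using \<gamma> \<Gamma>_sub by auto
      qed
      have "G \<in> M" using B G N(2) by (simp add: M_def)
      then show "{\<gamma>} \<subseteq> W \<inter> \<Gamma>" using \<gamma> G by (auto simp: W_def)
    qed
    ultimately show ?thesis by (auto simp: openin_subtopology)
  qed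
  moreover have "topspace (subtopology PU21_topology \<Gamma>) = \<Gamma>"
    using \<Gamma>_sub by (auto simp: topspace_PU21)
  ultimately have "discrete_topology \<Gamma> = subtopology PU21_topology \<Gamma>"
    by (simp add: discrete_topology_unique)
  then show ?thesis using \<Gamma> by (simp add: discrete_subgroup_def)
qed

section \<open>Alternating words\<close>

text \<open>
  Words that start with the involution \<open>J\<close> and alternate between \<open>J\<close> and elements of \<open>S\<close>, where only the
  last letter from \<open>S\<close> may be trivial.
\<close>

inductive_set alternating :: "(complex^3^3) set \<Rightarrow> complex^3^3 \<Rightarrow> (complex^3^3) set"
  for S J where
  alternating_base: "X \<in> S \<Longrightarrow> J ** X \<in> alternating S J"
| alternating_step: "Y \<in> alternating S J \<Longrightarrow> X \<in> S \<Longrightarrow> X \<noteq> mat 1 \<Longrightarrow>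
    J ** (X ** Y) \<in> alternating S J"

definition reduced_words :: "(complex^3^3) set \<Rightarrow> complex^3^3 \<Rightarrow> (complex^3^3) set" where
  "reduced_words S J = S \<union> {X ** Y |X Y. X \<in> S \<and> Y \<in> alternating S J}"

text \<open>
  Multiplication by \<open>J\<close> from the left either extends an alternating word or, if the first letter from
  \<open>S\<close> is trivial, cancels the leading \<open>J\<close>. Hence the reduced words exhaust the group generated by \<open>S\<close>
  and \<open>J\<close>.
\<close>

lemma reduced_words_mult:
  assumes S: "\<And>X Y. X \<in> S \<Longrightarrow> Y \<in> S \<Longrightarrow> X ** Y \<in> S" "mat 1 \<in> S" and J: "J ** J = mat 1"
    and Z: "Z \<in> reduced_words S J" and W: "W \<in> reduced_words S J"
  shows "Z ** W \<in> reduced_words S J"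
proof -
  have S_left: "X ** W \<in> reduced_words S J" if X: "X \<in> S" and W: "W \<in> reduced_words S J" for X W
    using W unfolding reduced_words_def
  proof
    assume "W \<in> {X ** Y |X Y. X \<in> S \<and> Y \<in> alternating S J}"
    then obtain X' Y where "W = X' ** Y" "X' \<in> S" "Y \<in> alternating S J" by auto
    then show "X ** W \<in> S \<union> {X ** Y |X Y. X \<in> S \<and> Y \<in> alternating S J}"
      using S(1)[OF X] matrix_mul_assoc[of X X' Y] by blast
  qed (use S(1)[OF X] in auto)
  have alt_reduced: "Y \<in> reduced_words S J" if "Y \<in> alternating S J" for Y
    using that S(2) matrix_mul_lid[of Y] unfolding reduced_words_def by force
  have J_left: "J ** W \<in> reduced_words S J" if W: "W \<in> reduced_words S J" for W
    using W unfolding reduced_words_def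
  proof
    assume "W \<in> S"
    then show "J ** W \<in> S \<union> {X ** Y |X Y. X \<in> S \<and> Y \<in> alternating S J}"
      using alt_reduced[OF alternating_base] by (simp add: reduced_words_def)
  next
    assume "W \<in> {X ** Y |X Y. X \<in> S \<and> Y \<in> alternating S J}"
    then obtain X Y where W: "W = X ** Y" "X \<in> S" "Y \<in> alternating S J" by auto
    have "J ** W \<in> reduced_words S J"
    proof (cases "X = mat 1")
      case False
      then show ?thesis using W alt_reduced[OF alternating_step] by simp
    next
      case True
      from W(3) show ?thesis
      proof cases
        case (alternating_base X')
        then show ?thesis using W(1) True J by (simp add: matrix_mul_assoc reduced_words_def)
      next
        case (alternating_step Y' X')
        then have "J ** W = X' ** Y'" using W(1) True J by (simp add: matrix_mul_assoc)
        then show ?thesis using alternating_step by (auto simp: reduced_words_def)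
      qed
    qed
    then show "J ** W \<in> S \<union> {X ** Y |X Y. X \<in> S \<and> Y \<in> alternating S J}"
      by (simp add: reduced_words_def)
  qed
  have alt_left: "Y ** W \<in> reduced_words S J" if "Y \<in> alternating S J" for Y
    using that
    by induction (auto simp: S_left J_left W simp flip: matrix_mul_assoc)
  consider "Z \<in> S" | X Y where "Z = X ** Y" "X \<in> S" "Y \<in> alternating S J"
    using Z unfolding reduced_words_def by blast
  then show ?thesis
    by cases (auto simp: S_left alt_left W simp flip: matrix_mul_assoc)
qed

section \<open>The stabiliser of the ideal vertex\<close>

lemma order_2_reflection_mult_vec:
  "herm c c = 1 \<Longrightarrow> minimal_reflection_matrix 2 c *v z = - z + (2 * herm z c) *s c"
  by (simp add: minimal_reflection_matrix_mult_vec)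

lemma matrix_vector_mult_uminus: "(- X) *v z = - (X *v (z :: complex^3))"
  by (simp add: vec_eq_iff matrix_vector_mult_def sum_negf)

text \<open>
  Changing the sign, which is invisible in \<open>PU(2,1)\<close>, turns the reflection into a map that fixes the
  orthogonal complement of \<open>c\<close> pointwise.
\<close>

lemma order_3_reflection_mult_vec:
  "herm c c = 1 \<Longrightarrow> (- minimal_reflection_matrix 3 c) *v z = z - ((1 - omega) * herm z c) *s c"
  by (simp add: minimal_reflection_matrix_mult_vec omega_def matrix_vector_mult_uminus)

lemma proj_class_uminus: "X \<in> carrier U21 \<Longrightarrow> - X \<in> carrier U21 \<and> proj_class (- X) = proj_class X"
proof -
  assume X: "X \<in> carrier U21"
  have "mat (- 1) ** X = - X" by (simp add: mat_matrix_mult vec_eq_iff)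
  then show ?thesis using proj_class_scale[OF X, of "- 1"] X
    by (simp add: U21_def matrix_vector_mult_uminus herm_minus_left herm_minus_right)
qed

text \<open>
  Polar vectors of a triangle whose first two sides are ideal, rescaled such that their product is \<open>1\<close>.
  The last two assumptions are what remains of \<open>m \<ge> ln 3\<close>, which says \<open>cosh\<^sup>2 (m / 2) \<ge> 4 / 3\<close>, and of
  \<open>cos \<alpha> \<le> - 1 / 2\<close>, which says that the two products with \<open>c3\<close> differ in direction by at least \<open>2 \<pi> / 3\<close>.
\<close>

locale ideal_triangle =
  fixes c1 c2 c3 :: "complex^3"
  assumes normalised: "herm c1 c1 = 1" "herm c2 c2 = 1" "herm c3 c3 = 1"
    and ideal: "herm c1 c2 = 1"
    and equidistant: "cmod (herm c1 c3) = cmod (herm c2 c3)"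
    and far: "4 \<le> 3 * (cmod (herm c1 c3))\<^sup>2"
    and wide: "3 * (cmod (herm c1 c3))\<^sup>2 \<le> (cmod (herm c1 c3 - herm c2 c3))\<^sup>2"
begin

text \<open>
  The null vector \<open>p\<close> spans the ideal vertex of the first two sides and \<open>q\<close> is its image under the
  involution \<open>J\<close>. The real number \<open>\<kappa>\<close> is \<open>\<langle>q, p\<rangle>\<close>; it fixes the radius of the isometric balls.
\<close>

definition p :: "complex^3" where "p = c1 - c2"
definition s :: complex where "s = herm c1 c3 - herm c2 c3"
definition \<kappa> :: real where "\<kappa> = 2 * (cmod s)\<^sup>2"
definition J :: "complex^3^3" where "J = minimal_reflection_matrix 2 c3"
definition q :: "complex^3" where "q = J *v p"

lemma ideal': "herm c2 c1 = 1"
  using ideal cnj_herm[of c1 c2] by simp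

lemma herm_p: "herm p p = 0" "herm p c1 = 0" "herm c1 p = 0" "herm p c2 = 0" "herm c2 p = 0"
    "herm p c3 = s" "herm c3 p = cnj s"
  by (simp_all add: p_def s_def herm_diff_left herm_diff_right normalised ideal ideal' cnj_herm)

lemma s_large: "4 \<le> (cmod s)\<^sup>2"
  using far wide by (simp add: s_def)

lemma kappa_pos: "0 < \<kappa>"
  using s_large by (auto simp: \<kappa>_def)

lemma p_nonzero: "p \<noteq> 0"
  using herm_p(6) s_large by auto

lemma J_mult_vec: "J *v z = - z + (2 * herm z c3) *s c3"
  unfolding J_def by (rule order_2_reflection_mult_vec[OF normalised(3)])

lemma J_U21: "J \<in> carrier U21"
  unfolding J_def by (rule minimal_reflection_matrix_U21) (simp add: normalised)

lemma J_J: "J ** J = mat 1"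
proof -
  have "(J ** J) *v z = mat 1 *v z" for z
    unfolding matrix_vector_mul_assoc[symmetric] J_mult_vec
    by (simp add: herm_expand normalised vec_eq_iff algebra_simps)
  then show ?thesis by (simp add: matrix_eq)
qed

lemma J_q: "J *v q = p"
  by (simp add: q_def matrix_vector_mul_assoc J_J)

lemma herm_q: "herm q q = 0" "herm q p = of_real \<kappa>" "herm p q = of_real \<kappa>"
proof -
  show "herm q q = 0" unfolding q_def herm_U21[OF J_U21] by (rule herm_p)
  show qp: "herm q p = of_real \<kappa>"
    unfolding q_def J_mult_vec
    by (simp add: herm_expand herm_p \<kappa>_def complex_norm_square del: of_real_power)
  show "herm p q = of_real \<kappa>" using cnj_herm[of q p] qp by simp
qed

lemma herm_q_c: "cmod (herm q c1) = 2 * cmod s * cmod (herm c1 c3)"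
    "cmod (herm q c1 - of_real \<kappa>) = cmod (herm q c1)"
proof -
  have 1: "herm q c1 = 2 * s * herm c3 c1" and 2: "herm q c2 = 2 * s * herm c3 c2"
    by (simp_all add: q_def J_mult_vec herm_expand herm_p)
  show "cmod (herm q c1) = 2 * cmod s * cmod (herm c1 c3)"
    by (simp add: 1 norm_mult cmod_herm_commute)
  have "herm q c1 - of_real \<kappa> = herm q c2"
    unfolding herm_q(2)[symmetric] p_def by (simp add: herm_diff_right)
  then show "cmod (herm q c1 - of_real \<kappa>) = cmod (herm q c1)"
    by (simp add: 1 2 norm_mult cmod_herm_commute equidistant)
qed

text \<open>
  Modulo signs, the two reflections of order 3 fix \<open>p\<close>, and with respect to the vectors \<open>c1\<close>, \<open>p\<close> and
  the functionals \<open>\<langle>_, c1\<rangle>\<close>, \<open>\<langle>_, p\<rangle>\<close> they differ from the identity by \<open>1 - omega\<close> times a matrix of Eisenstein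
  integers. The set of all such isometries is closed under products, and
  this arithmetic replaces a description of the group that the two reflections generate.
\<close>

definition stab :: "(complex^3^3) set" where
  "stab = {X \<in> carrier U21. \<exists>a\<in>eisenstein. \<exists>b\<in>eisenstein. \<exists>c\<in>eisenstein. \<exists>d\<in>eisenstein.
     \<forall>z. X *v z = z + ((1 - omega) * (a * herm z c1 + b * herm z p)) *s c1
                    + ((1 - omega) * (c * herm z c1 + d * herm z p)) *s p}"

lemma stab_U21: "X \<in> stab \<Longrightarrow> X \<in> carrier U21"
  by (simp add: stab_def)

lemma stab_p: "X \<in> stab \<Longrightarrow> X *v p = p"
  by (auto simp: stab_def herm_p)

lemma stabI:
  assumes "X \<in> carrier U21" "a \<in> eisenstein" "b \<in> eisenstein" "c \<in> eisenstein" "d \<in> eisenstein"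
    and "\<And>z. X *v z = z + ((1 - omega) * (a * herm z c1 + b * herm z p)) *s c1
                    + ((1 - omega) * (c * herm z c1 + d * herm z p)) *s p"
  shows "X \<in> stab"
  using assms unfolding stab_def by blast

lemma stab_one: "mat 1 \<in> stab"
  by (rule stabI[OF U21_one_closed, of 0 0 0 0]) (simp_all add: eisenstein_0)

lemma stab_mult:
  assumes X: "X \<in> stab" and Y: "Y \<in> stab"
  shows "X ** Y \<in> stab"
proof -
  obtain a b c d where X': "a \<in> eisenstein" "b \<in> eisenstein" "c \<in> eisenstein" "d \<in> eisenstein"
    "\<And>z. X *v z = z + ((1 - omega) * (a * herm z c1 + b * herm z p)) *s c1
                    + ((1 - omega) * (c * herm z c1 + d * herm z p)) *s p"
    using X unfolding stab_def by blast
  obtain a' b' c' d' where Y': "a' \<in> eisenstein" "b' \<in> eisenstein" "c' \<in> eisenstein" "d' \<in> eisenstein"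
    "\<And>z. Y *v z = z + ((1 - omega) * (a' * herm z c1 + b' * herm z p)) *s c1
                    + ((1 - omega) * (c' * herm z c1 + d' * herm z p)) *s p"
    using Y unfolding stab_def by blast
  show ?thesis
  proof (rule stabI)
    show "X ** Y \<in> carrier U21" using X Y by (simp add: U21_mult_closed stab_U21)
    show "a + a' + (1 - omega) * (a * a') \<in> eisenstein"
      "b + b' + (1 - omega) * (a * b') \<in> eisenstein"
      "c + c' + (1 - omega) * (c * a') \<in> eisenstein"
      "d + d' + (1 - omega) * (c * b') \<in> eisenstein"
      by (simp_all add: eisenstein_intros X'(1-4) Y'(1-4))
    fix z
    define f where "f = herm z c1"
    define g where "g = herm z p"
    have f: "herm (Y *v z) c1 = f + (1 - omega) * (a' * f + b' * g)"
      and g: "herm (Y *v z) p = g"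
      by (simp_all add: Y'(5) herm_expand herm_p normalised f_def g_def)
    show "(X ** Y) *v z = z
      + ((1 - omega) * ((a + a' + (1 - omega) * (a * a')) * herm z c1
          + (b + b' + (1 - omega) * (a * b')) * herm z p)) *s c1
      + ((1 - omega) * ((c + c' + (1 - omega) * (c * a')) * herm z c1
          + (d + d' + (1 - omega) * (c * b')) * herm z p)) *s p"
      unfolding matrix_vector_mul_assoc[symmetric] X'(5)[of "Y *v z"] f g
      unfolding Y'(5)[of z] f_def[symmetric] g_def[symmetric]
      by (simp add: vec_eq_iff algebra_simps)
  qed
qed

lemma reflections_in_stab:
  "- minimal_reflection_matrix 3 c1 \<in> stab" "- minimal_reflection_matrix 3 c2 \<in> stab"
proof -
  have U: "- minimal_reflection_matrix 3 c1 \<in> carrier U21"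
    "- minimal_reflection_matrix 3 c2 \<in> carrier U21"
    using proj_class_uminus minimal_reflection_matrix_U21 normalised by auto
  show "- minimal_reflection_matrix 3 c1 \<in> stab"
    by (rule stabI[OF U(1), of "- 1" 0 0 0])
      (simp_all add: eisenstein_intros order_3_reflection_mult_vec normalised vec_eq_iff)
  have "(- minimal_reflection_matrix 3 c2) *v z
      = z + ((1 - omega) * (- 1 * herm z c1 + 1 * herm z p)) *s c1
          + ((1 - omega) * (1 * herm z c1 + - 1 * herm z p)) *s p" for z
  proof -
    have h: "herm z c2 = herm z c1 - herm z p" by (simp add: p_def herm_diff_right)
    have c1: "c1 $ i = c2 $ i + p $ i" for i by (simp add: p_def)
    show ?thesis
      unfolding order_3_reflection_mult_vec[OF normalised(2)] h
      by (simp add: vec_eq_iff c1 algebra_simps)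
  qed
  then show "- minimal_reflection_matrix 3 c2 \<in> stab"
    by (intro stabI[OF U(2), of "- 1" 1 1 "- 1"]) (simp_all add: eisenstein_intros)
qed

text \<open>
  With \<open>x = \<langle>q, c1\<rangle> / \<kappa>\<close> as horizontal coordinate of \<open>q\<close>, the element of the stabiliser moves \<open>x\<close> by
  \<open>(1 - omega) (a x + b)\<close>. For \<open>a = 0\<close> it is a translation by a lattice vector. Otherwise the unitarity
  condition forces \<open>a\<close> to be an Eisenstein unit, and the element rotates by \<open>\<plusminus> 2 \<pi> / 3\<close> about a lattice
  point. Since \<open>x\<close> lies on the Voronoi edge between the centres \<open>0\<close> and \<open>1\<close> of the two reflections, these
  two rotations move it least. The bound \<open>8 \<kappa>\<close> is what yields the product \<open>4 \<kappa>\<close> that separates two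
  isometric balls.
\<close>

lemma eisenstein_displacement:
  assumes a: "a \<in> eisenstein" and b: "b \<in> eisenstein" and ab: "a \<noteq> 0 \<or> b \<noteq> 0"
    and unit: "cmod (1 + (1 - omega) * a) = 1"
  shows "8 * \<kappa> \<le> 3 * (cmod (a * herm q c1 + b * of_real \<kappa>))\<^sup>2"
proof -
  define x where "x = herm q c1 / of_real \<kappa>"
  define y where "y = (cmod (a * x + b))\<^sup>2"
  have eq: "a * herm q c1 + b * of_real \<kappa> = of_real \<kappa> * (a * x + b)"
    using kappa_pos by (simp add: x_def field_simps)
  have "x - 1 = (herm q c1 - of_real \<kappa>) / of_real \<kappa>"
    using kappa_pos by (simp add: x_def field_simps)
  then have mid: "cmod x = cmod (x - 1)"
    by (simp add: x_def norm_divide herm_q_c(2))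
  have s0: "cmod s \<noteq> 0" using s_large by auto
  have x: "(cmod s)\<^sup>2 * (cmod x)\<^sup>2 = (cmod (herm c1 c3))\<^sup>2"
  proof -
    have "cmod x = 2 * cmod s * cmod (herm c1 c3) / \<kappa>"
      using kappa_pos by (simp add: x_def norm_divide herm_q_c(1))
    then have "cmod s * cmod x = cmod (herm c1 c3)"
      using s0 by (simp add: \<kappa>_def power2_eq_square)
    then show ?thesis by (metis power_mult_distrib)
  qed
  have small: "3 * (cmod x)\<^sup>2 \<le> 1"
  proof -
    have "(cmod s)\<^sup>2 * (3 * (cmod x)\<^sup>2) \<le> (cmod s)\<^sup>2 * 1"
      using x wide by (simp add: s_def)
    moreover have "0 < (cmod s)\<^sup>2" using s_large by linarith
    ultimately show ?thesis by (simp only: mult_le_cancel_left_pos)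
  qed
  have "4 \<le> 3 * ((cmod s)\<^sup>2 * y)"
  proof (cases "a = 0")
    case True
    then have "1 \<le> y" using ab b eisenstein_cmod_ge_1 by (simp add: y_def)
    then have "4 * 1 \<le> (cmod s)\<^sup>2 * y" using s_large by (intro mult_mono) auto
    then show ?thesis by simp
  next
    case False
    have "cmod ((1 - omega) * a) \<le> 2"
      using norm_triangle_ineq4[of "1 + (1 - omega) * a" 1] unit by simp
    then have "(cmod ((1 - omega) * a))\<^sup>2 \<le> 2\<^sup>2" by (intro power_mono) auto
    then have "3 * (cmod a)\<^sup>2 \<le> 4" by (simp add: norm_mult power_mult_distrib cmod_one_minus_omega)
    then have a1: "(cmod a)\<^sup>2 = 1" using eisenstein_small_unit[OF a False] by simp
    then have aa: "a * cnj a = 1" using complex_norm_square[of a] by simp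
    have "a * x + b = a * (x + cnj a * b)" using aa by (simp add: algebra_simps)
    then have "y = (cmod (x + cnj a * b))\<^sup>2" using a1 by (simp add: y_def norm_mult power_mult_distrib)
    also have "\<dots> \<ge> (cmod x)\<^sup>2"
      using eisenstein_voronoi_edge[OF mid small eisenstein_mult[OF eisenstein_cnj[OF a] b]]
      by (intro power_mono) auto
    finally have "(cmod s)\<^sup>2 * (cmod x)\<^sup>2 \<le> (cmod s)\<^sup>2 * y" by (intro mult_left_mono) auto
    then show ?thesis using x far by simp
  qed
  then have "8 \<le> 3 * (\<kappa> * y)" by (simp add: \<kappa>_def mult_ac)
  then have "\<kappa> * 8 \<le> \<kappa> * (3 * (\<kappa> * y))" using kappa_pos by (intro mult_left_mono) auto
  then show ?thesis
    unfolding eq norm_mult power_mult_distrib y_def[symmetric] by (simp add: power2_eq_square mult_ac)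
qed

text \<open>
  The isometric ball of \<open>J\<close> is moved off itself by every nontrivial element of the stabiliser. If the
  element has a nontrivial horizontal part, the horizontal displacement is large enough, because
  \<open>- 2 Re \<langle>q, X q\<rangle>\<close> is its square. Otherwise the element is a vertical translation by \<open>1 - omega\<close> times a
  nonzero Eisenstein integer.
\<close>

lemma stab_displacement:
  assumes X: "X \<in> stab" and X1: "X \<noteq> mat 1"
  shows "4 * \<kappa> \<le> cmod (herm q (X *v q))"
proof -
  obtain a b c d where e: "a \<in> eisenstein" "b \<in> eisenstein" "c \<in> eisenstein" "d \<in> eisenstein"
    and X': "\<And>z. X *v z = z + ((1 - omega) * (a * herm z c1 + b * herm z p)) *s c1
                    + ((1 - omega) * (c * herm z c1 + d * herm z p)) *s p"
    using X unfolding stab_def by blast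
  note U = herm_U21[OF stab_U21[OF X]]
  define u where "u = 1 + (1 - omega) * a"
  have Xc1: "X *v c1 = u *s c1 + ((1 - omega) * c) *s p"
    unfolding X'[of c1] by (simp add: normalised herm_p u_def vec_eq_iff algebra_simps)
  have "herm (X *v c1) (X *v c1) = u * cnj u"
    unfolding Xc1 by (simp add: herm_expand normalised herm_p)
  then have "complex_of_real ((cmod u)\<^sup>2) = 1" unfolding U normalised complex_norm_square by simp
  then have "(cmod u)\<^sup>2 = 1\<^sup>2" unfolding of_real_eq_1_iff by simp
  then have u: "cmod u = 1" by (subst (asm) power2_eq_iff_nonneg) auto
  show ?thesis
  proof (cases "a = 0 \<and> b = 0")
    case False
    define v where "v = a * herm q c1 + b * of_real \<kappa>"
    have diff: "X *v q - q = ((1 - omega) * v) *s c1 + ((1 - omega) * (c * herm q c1 + d * of_real \<kappa>)) *s p"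
      unfolding X'[of q] herm_q v_def by simp
    have "herm (X *v q - q) (X *v q - q) = ((1 - omega) * v) * cnj ((1 - omega) * v)"
      unfolding diff by (simp add: herm_expand normalised herm_p)
    also have "\<dots> = of_real ((cmod ((1 - omega) * v))\<^sup>2)"
      by (simp only: complex_norm_square)
    also have "\<dots> = of_real (3 * (cmod v)\<^sup>2)"
      by (simp only: norm_mult power_mult_distrib cmod_one_minus_omega)
    finally have "3 * (cmod v)\<^sup>2 = Re (herm (X *v q - q) (X *v q - q))" by simp
    also have "herm (X *v q - q) (X *v q - q) = - herm (X *v q) q - herm q (X *v q)"
      by (simp add: herm_diff_left herm_diff_right U herm_q)
    also have "Re (- herm (X *v q) q - herm q (X *v q)) = - 2 * Re (herm q (X *v q))"
      using cnj_herm[of q "X *v q"] by (simp add: complex_eq_iff)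
    finally have "3 * (cmod v)\<^sup>2 \<le> 2 * cmod (herm q (X *v q))"
      using abs_Re_le_cmod[of "herm q (X *v q)"] by linarith
    moreover have "8 * \<kappa> \<le> 3 * (cmod v)\<^sup>2"
      unfolding v_def using eisenstein_displacement[OF e(1,2)] False u by (simp add: u_def)
    ultimately show ?thesis by simp
  next
    case True
    have Xq: "X *v q = q + ((1 - omega) * (c * herm q c1 + d * of_real \<kappa>)) *s p"
      unfolding X'[of q] using True by (simp add: herm_q)
    have "herm q c1 = herm (X *v q) (X *v c1)" by (simp add: U)
    also have "\<dots> = herm q c1 + cnj ((1 - omega) * c) * of_real \<kappa>"
      unfolding Xq Xc1 using True by (simp add: herm_expand herm_p herm_q u_def)
    finally have c0: "c = 0" using kappa_pos cmod_one_minus_omega by auto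
    have "d \<noteq> 0"
    proof
      assume "d = 0"
      then have "X *v z = mat 1 *v z" for z using True c0 by (simp add: X')
      then show False using X1 by (simp add: matrix_eq)
    qed
    then have d: "1 \<le> (cmod d)\<^sup>2" using e eisenstein_cmod_ge_1 by blast
    have "(cmod (herm (X *v q) q))\<^sup>2 = (cmod (1 - omega))\<^sup>2 * (cmod d)\<^sup>2 * (\<kappa>\<^sup>2)\<^sup>2"
      unfolding Xq c0 using kappa_pos
      by (simp add: herm_expand herm_q norm_mult power_mult_distrib power2_eq_square mult_ac)
    also have "\<dots> \<ge> 3 * 1 * (\<kappa>\<^sup>2)\<^sup>2"
      unfolding cmod_one_minus_omega using d by (intro mult_right_mono) auto
    finally have "3 * (\<kappa>\<^sup>2)\<^sup>2 \<le> (cmod (herm q (X *v q)))\<^sup>2"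
      by (simp add: cmod_herm_commute)
    moreover have "(4 * \<kappa>)\<^sup>2 \<le> 3 * (\<kappa>\<^sup>2)\<^sup>2"
    proof -
      have "8 * 8 \<le> \<kappa> * \<kappa>" using s_large by (intro mult_mono) (auto simp: \<kappa>_def)
      then have "\<kappa>\<^sup>2 * 16 \<le> \<kappa>\<^sup>2 * (3 * \<kappa>\<^sup>2)" by (intro mult_left_mono) (auto simp: power2_eq_square)
      then show ?thesis by (simp add: power2_eq_square mult_ac)
    qed
    ultimately have "(4 * \<kappa>)\<^sup>2 \<le> (cmod (herm q (X *v q)))\<^sup>2" by simp
    then show ?thesis by (rule power2_le_imp_le) simp
  qed
qed

section \<open>Ping-pong\<close>

text \<open>
  The isometric ball of \<open>J\<close>. It is taken closed, because
  disjointness of a closed ball from an open one only gives the weak outer inequality, which \<open>J\<close> turns into the weak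
  inner one.
\<close>

definition ball_q :: "(complex^3) set" where
  "ball_q = {z. Re (herm z z) < 0 \<and> cmod (herm z q) \<le> cmod (herm z p)}"

definition horoball :: "(complex^3) set" where
  "horoball = {z. 2 * (cmod (herm z p))\<^sup>2 < - Re (herm z z) * \<kappa>}"

lemma herm_stab_p: "X \<in> stab \<Longrightarrow> herm (X *v z) p = herm z p"
  using herm_U21[OF stab_U21, of X z p] stab_p by simp

text \<open>
  Ping-pong: \<open>J\<close> maps the closed complement of its isometric ball into the ball, and a nontrivial element
  of the stabiliser maps the ball into the closed complement. The horoball lies outside the ball and is
  preserved by the stabiliser, so that it serves as the starting point.
\<close>

lemma alternating_horoball:
  assumes "Y \<in> alternating stab J" and z: "z \<in> horoball"
  shows "Y *v z \<in> ball_q"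
  using assms(1)
proof induction
  have J_ball: "J *v y \<in> ball_q" if "Re (herm y y) < 0" "cmod (herm y p) \<le> cmod (herm y q)" for y
  proof -
    have "herm (J *v y) q = herm y p" unfolding q_def by (rule herm_U21[OF J_U21])
    moreover have "herm (J *v y) p = herm y q" using herm_U21[OF J_U21, of y q] by (simp add: J_q)
    ultimately show ?thesis using that by (simp add: ball_q_def herm_U21[OF J_U21])
  qed
  {
    case (alternating_base X)
    have X: "X *v z \<in> horoball"
      using z by (simp add: horoball_def herm_U21 stab_U21 herm_stab_p alternating_base)
    have "0 < - Re (herm (X *v z) (X *v z)) * \<kappa>"
      using X zero_le_power2[of "cmod (herm (X *v z) p)"] unfolding horoball_def mem_Collect_eq by linarith
    then have "Re (herm (X *v z) (X *v z)) < 0" using kappa_pos by (simp add: mult_less_0_iff)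
    moreover have "cmod (herm (X *v z) p) < cmod (herm (X *v z) q)"
      using isometric_ball_below_horoball[OF p_nonzero herm_p(1) herm_q(1,2) kappa_pos] X
      by (simp add: horoball_def)
    ultimately show ?case using J_ball by (simp flip: matrix_vector_mul_assoc)
  next
    case (alternating_step Y X)
    define y where "y = Y *v z"
    have y: "y \<in> ball_q" using alternating_step by (simp add: y_def)
    have XU: "X \<in> carrier U21" using alternating_step stab_U21 by blast
    have neg: "Re (herm (X *v y) (X *v y)) < 0" using y by (simp add: ball_q_def herm_U21[OF XU])
    \<comment> \<open>Otherwise \<open>X y\<close> lies in the open ball around \<open>q\<close> and in the closed ball around \<open>X q\<close>, which are
      disjoint.\<close>
    have "cmod (herm (X *v y) p) \<le> cmod (herm (X *v y) q)"
    proof (rule ccontr)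
      assume "\<not> ?thesis"
      moreover have "cmod (herm (X *v y) (X *v q)) \<le> cmod (herm (X *v y) p)"
        using y alternating_step by (simp add: ball_q_def herm_U21[OF XU] herm_stab_p)
      ultimately have "cmod (herm (X *v q) q) < 4 * \<kappa>"
        using neg herm_q herm_stab_p alternating_step
        by (intro isometric_balls_disjoint[OF p_nonzero herm_p(1) _ _ _ _ kappa_pos, of _ _ "X *v y"])
          (auto simp: herm_U21[OF XU])
      then show False
        using stab_displacement[of X] alternating_step by (simp add: cmod_herm_commute)
    qed
    with neg have "J *v (X *v y) \<in> ball_q" by (rule J_ball)
    then show ?case by (simp add: y_def matrix_vector_mul_assoc matrix_mul_assoc)
  }
qed

lemma stab_ball_q_horoball:
  assumes X: "X \<in> stab" and z: "z \<in> ball_q"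
  shows "X *v z \<notin> horoball"
proof
  assume "X *v z \<in> horoball"
  then have "cmod (herm (X *v z) p) < cmod (herm (X *v z) (X *v q))"
    using herm_q X
    by (intro isometric_ball_below_horoball[OF p_nonzero herm_p(1) _ _ kappa_pos])
      (auto simp: horoball_def herm_U21 stab_U21 herm_stab_p)
  then show False using X z by (simp add: herm_U21 stab_U21 herm_stab_p ball_q_def)
qed

text \<open>
  Any factor strictly between 0 and 1 in place of 1/2 gives a point of the horoball.
\<close>

definition horoball_point :: "complex^3" where
  "horoball_point = p - (1 / 2) *s q"

lemma horoball_point: "horoball_point \<in> horoball"
proof -
  have self: "herm horoball_point horoball_point = - of_real \<kappa>"
    by (simp add: horoball_point_def herm_expand herm_p herm_q)
  have "herm horoball_point p = - of_real (\<kappa> / 2)"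
    by (simp add: horoball_point_def herm_expand herm_p herm_q)
  then have cm: "cmod (herm horoball_point p) = \<kappa> / 2"
    using kappa_pos by (simp del: of_real_divide)
  have "2 * (\<kappa> / 2)\<^sup>2 < \<kappa> * \<kappa>" using kappa_pos by (simp add: power2_eq_square)
  then show ?thesis by (simp add: horoball_def cm self)
qed

text \<open>
  The first condition excludes the nontrivial elements of the stabiliser, which move \<open>q\<close> too far. The
  second one excludes all words that involve \<open>J\<close>, because they move the horoball off itself.
\<close>

definition identity_nbhd :: "(complex^3^3) set" where
  "identity_nbhd = {X \<in> carrier U21. cmod (herm q (X *v q)) < 4 * \<kappa> \<and> X *v horoball_point \<in> horoball}"

lemma identity_nbhd_open: "openin (top_of_set (carrier U21)) identity_nbhd"
proof -
  have cont: "continuous_on UNIV (\<lambda>X. herm (X *v v) w)" "continuous_on UNIV (\<lambda>X. herm w (X *v v))"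
    "continuous_on UNIV (\<lambda>X. herm (X *v v) (X *v v))" for v w
    unfolding herm_def matrix_vector_mult_def by (simp_all, (intro continuous_intros)+)
  have "open {X. cmod (herm q (X *v q)) < 4 * \<kappa>}"
    by (intro open_Collect_less continuous_intros cont)
  moreover have "open {X. X *v horoball_point \<in> horoball}"
    unfolding horoball_def mem_Collect_eq by (intro open_Collect_less continuous_intros cont)
  ultimately have "open ({X. cmod (herm q (X *v q)) < 4 * \<kappa>} \<inter> {X. X *v horoball_point \<in> horoball})"
    by (rule open_Int)
  moreover have "identity_nbhd = carrier U21 \<inter>
      ({X. cmod (herm q (X *v q)) < 4 * \<kappa>} \<inter> {X. X *v horoball_point \<in> horoball})"
    by (auto simp: identity_nbhd_def)
  ultimately show ?thesis using openin_open_Int by metis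
qed

lemma identity_nbhd_one: "mat 1 \<in> identity_nbhd"
  using kappa_pos by (simp add: identity_nbhd_def U21_one_closed herm_q horoball_point)

lemma identity_nbhd_scale:
  assumes X: "X \<in> identity_nbhd" and k: "cmod k = 1"
  shows "mat k ** X \<in> identity_nbhd"
proof -
  have "mat k \<in> carrier U21" using k unit_scalars_subset by (auto simp: unit_scalars_def)
  then have U: "mat k ** X \<in> carrier U21" using X by (simp add: identity_nbhd_def U21_mult_closed)
  have "cnj k * k = 1" using k complex_norm_square[of k] by (simp add: mult.commute)
  then have kk: "herm (k *s z) (k *s z) = herm z z" for z
    by (simp add: herm_scale_left herm_scale_right flip: mult.assoc)
  have "(mat k ** X) *v z = k *s (X *v z)" for z
    by (simp add: mat_mult_vec flip: matrix_vector_mul_assoc)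
  then show ?thesis
    using X U k
    by (simp add: identity_nbhd_def horoball_def kk herm_scale_left[of _ _ p] herm_scale_right[of q]
        norm_mult)
qed

lemma reduced_words_identity_nbhd:
  assumes X: "X \<in> reduced_words stab J" "X \<in> identity_nbhd"
  shows "X = mat 1"
proof -
  consider "X \<in> stab" | Z Y where "X = Z ** Y" "Z \<in> stab" "Y \<in> alternating stab J"
    using X(1) unfolding reduced_words_def by blast
  then show ?thesis
  proof cases
    case 1
    then show ?thesis using stab_displacement[of X] X(2) by (force simp: identity_nbhd_def)
  next
    case 2
    then have "X *v horoball_point \<notin> horoball"
      using alternating_horoball[OF 2(3) horoball_point] stab_ball_q_horoball
      by (simp flip: matrix_vector_mul_assoc)
    then show ?thesis using X(2) by (simp add: identity_nbhd_def)
  qed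
qed

lemma reduced_words_U21: "X \<in> reduced_words stab J \<Longrightarrow> X \<in> carrier U21"
proof -
  have "Y \<in> carrier U21" if "Y \<in> alternating stab J" for Y
    using that by induction (auto intro: U21_mult_closed J_U21 stab_U21)
  then show "X \<in> reduced_words stab J \<Longrightarrow> X \<in> carrier U21"
    by (auto simp: reduced_words_def intro: U21_mult_closed stab_U21)
qed

lemma order_3_reflection_cube:
  assumes "herm c c = 1"
  defines "A \<equiv> - minimal_reflection_matrix 3 c"
  shows "A ** (A ** A) = mat 1"
proof -
  have h: "herm (A *v z) c = omega * herm z c" for z
    unfolding A_def order_3_reflection_mult_vec[OF assms(1)] by (simp add: herm_expand assms algebra_simps)
  have "(A ** (A ** A)) *v z = z - ((1 - omega) * (1 + omega + omega * omega) * herm z c) *s c" for z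
    unfolding matrix_vector_mul_assoc[symmetric]
    unfolding A_def order_3_reflection_mult_vec[OF assms(1), of "A *v _", unfolded A_def]
      order_3_reflection_mult_vec[OF assms(1)]
    by (simp add: herm_expand assms vec_eq_iff algebra_simps)
  then have "(A ** (A ** A)) *v z = mat 1 *v z" for z by (simp add: omega_square)
  then show ?thesis by (simp add: matrix_eq)
qed

lemma discrete:
  "discrete_subgroup (generate PU21 {proj_class (minimal_reflection_matrix 3 c1),
     proj_class (minimal_reflection_matrix 3 c2), proj_class (minimal_reflection_matrix 2 c3)})"
  (is "discrete_subgroup (generate PU21 ?gens)")
proof -
  interpret PU: group PU21 by (rule group_PU21)
  let ?W = "reduced_words stab J"
  have W_mult: "X ** Y \<in> ?W" if "X \<in> ?W" "Y \<in> ?W" for X Y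
    using reduced_words_mult[of stab J X Y] stab_mult stab_one J_J that by blast
  have stab_W: "X \<in> ?W" if "X \<in> stab" for X using that by (simp add: reduced_words_def)
  have J_W: "J \<in> ?W"
    using alternating_base[OF stab_one, of J] stab_one matrix_mul_lid[of J]
    unfolding reduced_words_def by force
  have R: "minimal_reflection_matrix n c \<in> carrier U21" if "herm c c = 1" for n c
    using minimal_reflection_matrix_U21 that by simp
  have gens: "\<exists>X\<in>?W. \<exists>Y\<in>?W. g = proj_class X \<and> X ** Y = mat 1 \<and> Y ** X = mat 1" if "g \<in> ?gens" for g
  proof -
    have refl: "\<exists>X\<in>?W. \<exists>Y\<in>?W. proj_class (minimal_reflection_matrix 3 c) = proj_class X
        \<and> X ** Y = mat 1 \<and> Y ** X = mat 1"
      if c: "herm c c = 1" "- minimal_reflection_matrix 3 c \<in> stab" for c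
      using order_3_reflection_cube[OF c(1)] stab_W[OF c(2)] W_mult proj_class_uminus[OF R[OF c(1), of 3]]
        matrix_mul_assoc by metis
    show ?thesis
      using that refl[OF normalised(1) reflections_in_stab(1)] refl[OF normalised(2) reflections_in_stab(2)]
        J_W J_J unfolding J_def by blast
  qed
  have gens_carrier: "?gens \<subseteq> carrier PU21"
    using R normalised by (auto simp: carrier_PU21)
  have words: "\<gamma> \<in> proj_class ` ?W" if "\<gamma> \<in> generate PU21 ?gens" for \<gamma>
    using that
  proof induction
    case one
    show ?case using stab_W[OF stab_one] proj_class_one by force
  next
    case (incl g)
    then show ?case using gens[OF incl] by auto
  next
    case (inv g)
    then obtain X Y where XY: "X \<in> ?W" "Y \<in> ?W" "g = proj_class X" "Y ** X = mat 1"
      using gens[OF inv] by auto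
    have "inv\<^bsub>PU21\<^esub> g = proj_class Y"
      using XY proj_class_mult[of Y X] reduced_words_U21
      by (intro PU.inv_equality) (auto simp: proj_class_one carrier_PU21)
    then show ?case using XY by auto
  next
    case (eng g h)
    then obtain X Y where "X \<in> ?W" "Y \<in> ?W" "g = proj_class X" "h = proj_class Y" by auto
    then show ?case using W_mult proj_class_mult reduced_words_U21 by auto
  qed
  show ?thesis
  proof (rule discrete_subgroupI[OF PU.generate_is_subgroup[OF gens_carrier]
        identity_nbhd_open identity_nbhd_one identity_nbhd_scale])
    fix X assume X: "X \<in> identity_nbhd" "proj_class X \<in> generate PU21 ?gens"
    then obtain Y where Y: "Y \<in> ?W" "proj_class Y = proj_class X" using words by fastforce
    then obtain k where "cmod k = 1" "Y = mat k ** X"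
      using proj_class_eqE[OF reduced_words_U21] by metis
    then have "Y \<in> identity_nbhd" using X identity_nbhd_scale by simp
    then show "proj_class X = \<one>\<^bsub>PU21\<^esub>"
      using reduced_words_identity_nbhd[OF Y(1)] Y(2) proj_class_one by simp
  qed
qed

end

section \<open>From the triangle to its Gram matrix\<close>

theorem proposition1:
  fixes m \<alpha> :: real and \<Gamma> :: "(complex^3^3) set set"
  assumes "0 \<le> m" and "\<alpha> \<in> {0..2 * pi}"
    and "triangle_group m m 0 3 3 2 \<alpha> \<Gamma>"
    and "ln 3 \<le> m" and "cos \<alpha> \<le> - 1 / 2"
  shows "discrete_subgroup \<Gamma>"
proof -
  obtain C1 C2 C3 where tri: "is_triangle C1 C2 C3 m m 0" and ang: "angular_invariant C1 C2 C3 \<alpha>"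
    and \<Gamma>: "\<Gamma> = generate PU21 {minimal_reflection 3 C1, minimal_reflection 3 C2, minimal_reflection 2 C3}"
    using assms(3) unfolding triangle_group_def by (elim exE conjE) (rule that)
  obtain c1 c2 c3 where c: "normalised_polar_vector C1 c1" "normalised_polar_vector C2 c2"
      "normalised_polar_vector C3 c3"
    and arg: "is_Arg (herm c3 c2 * herm c1 c3 * herm c2 c1) \<alpha>"
    using ang unfolding angular_invariant_def by (elim exE conjE) (rule that)
  have polar: "polar_vector C1 c1" "polar_vector C2 c2" "polar_vector C3 c3"
    and norm: "herm c1 c1 = 1" "herm c2 c2 = 1" "herm c3 c3 = 1"
    using c by (auto simp: normalised_polar_vector_def)
  have pairs: "ultra_parallel C2 C3 \<or> ideal_pair C2 C3" "ultra_parallel C3 C1 \<or> ideal_pair C3 C1"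
      "ultra_parallel C1 C2 \<or> ideal_pair C1 C2"
    and m: "m = geodesic_dist C3 C2" "m = geodesic_dist C1 C3" "0 = geodesic_dist C2 C1"
    using tri by (simp_all add: is_triangle_def)
  have ge: "1 \<le> cmod (herm c3 c2)" "1 \<le> cmod (herm c1 c3)" "1 \<le> cmod (herm c2 c1)"
    using ultra_parallel_or_ideal_cmod_herm[OF c(2,3) pairs(1)]
      ultra_parallel_or_ideal_cmod_herm[OF c(3,1) pairs(2)]
      ultra_parallel_or_ideal_cmod_herm[OF c(1,2) pairs(3)]
    by (simp_all only: cmod_herm_commute[of c3 c2] cmod_herm_commute[of c1 c3] cmod_herm_commute[of c2 c1])
  have cosh_half: "t = cosh (x / 2)" if "x = 2 * arcosh t" "1 \<le> t" for x t :: real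
    using that by simp
  have dist: "cmod (herm c3 c2) = cosh (m / 2)" "cmod (herm c1 c3) = cosh (m / 2)"
    using m(1) geodesic_dist_eq_arcosh[OF c(3,2) ge(1)] m(2) geodesic_dist_eq_arcosh[OF c(1,3) ge(2)]
    by (intro cosh_half ge; linarith)+
  have "cmod (herm c2 c1) = cosh (0 / 2)"
    using m(3) geodesic_dist_eq_arcosh[OF c(2,1) ge(3)] by (intro cosh_half ge) linarith
  then have ideal: "cmod (herm c2 c1) = 1" by simp
  define R where "R = (cosh (m / 2))\<^sup>2"
  have R: "4 \<le> 3 * R"
  proof -
    have "cosh (ln 3) \<le> cosh m"
      using assms(1,4) by (subst cosh_real_nonneg_le_iff) auto
    moreover have "cosh (ln 3) = (5 / 3 :: real)"
      by (simp add: cosh_ln_real)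
    moreover have "cosh m = 2 * R - 1"
      using cosh_double_cosh[of "m / 2"] by (simp add: R_def)
    ultimately show ?thesis by simp
  qed
  define k where "k = herm c1 c2"
  have k: "cmod k = 1" "k * cnj k = 1"
    using ideal complex_norm_square[of k] by (simp_all add: k_def cmod_herm_commute)
  \<comment> \<open>The phase of the second polar vector is free; this choice gives product 1 with \<open>c1\<close>.\<close>
  define d where "d = k *s c2"
  have d: "herm d d = 1" "herm c1 d = 1"
    using k norm by (simp_all add: d_def herm_expand k_def mult_ac)
  have k0: "k \<noteq> 0" using k by auto
  define g where "g = herm c1 c3"
  define h where "h = herm d c3"
  have g: "(cmod g)\<^sup>2 = R" and h: "(cmod h)\<^sup>2 = R" and gh: "cmod g = cmod h"
    using dist k by (simp_all add: g_def h_def d_def herm_scale_left norm_mult R_def cmod_herm_commute)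
  have "herm c3 c2 * herm c1 c3 * herm c2 c1 = g * cnj h"
    by (simp add: g_def h_def d_def herm_scale_left k_def cnj_herm mult_ac)
  then have "g * cnj h = of_real (cmod (g * cnj h)) * exp (\<i> * of_real \<alpha>)"
    using arg by (simp add: is_Arg_def)
  then have "g * cnj h = of_real R * cis \<alpha>"
    using gh h by (simp add: norm_mult cis_conv_exp power2_eq_square flip: of_real_mult)
  then have "Re (g * cnj h) = R * cos \<alpha>" by simp
  moreover have "(cmod (g - h))\<^sup>2 = (cmod g)\<^sup>2 + (cmod h)\<^sup>2 - 2 * Re (g * cnj h)"
    unfolding cmod_power2 by (simp add: power2_eq_square algebra_simps)
  ultimately have "(cmod (g - h))\<^sup>2 = 2 * R - 2 * (R * cos \<alpha>)" using g h by simp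
  moreover have "R * cos \<alpha> \<le> R * (- 1 / 2)" using R assms(5) by (intro mult_left_mono) auto
  ultimately have wide: "3 * R \<le> (cmod (g - h))\<^sup>2" by simp
  interpret ideal_triangle c1 d c3
    by unfold_locales (use norm d gh g R wide in \<open>auto simp: g_def h_def\<close>)
  have "polar_vector C2 d"
  proof -
    have "herm d z = 0 \<longleftrightarrow> herm c2 z = 0" for z using k0 by (simp add: d_def herm_scale_left)
    then show ?thesis using polar(2) d by (simp add: polar_vector_def)
  qed
  then have "\<Gamma> = generate PU21 {proj_class (minimal_reflection_matrix 3 c1),
     proj_class (minimal_reflection_matrix 3 d), proj_class (minimal_reflection_matrix 2 c3)}"
    unfolding \<Gamma> using polar minimal_reflection_eq by simp
  then show ?thesis using discrete by simp
qed

end
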